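(* Let $p\in(0,1)$ be a constant. Let $X_n$ be the number of perfect matchings in $B(n,p)$, where the random bipartite graphs $B(n,p)$, $n\in\mathbb N$, are all obtained by restriction from a single infinite random bipartite graph $B(\mathbb N,p)$, and set $Y_n:=\log X_n$. Then $$\Pr\left[\limsup_{n\to\infty}\frac{Y_n-\log(n!\,p^n)+\frac{1-p}{2p}}{\sqrt{2\log\log n}\,\sqrt{\frac{1-p}{p}}}=1\right]=1.$$
   Context: $B(\mathbb N,p)$ is the random bipartite graph on vertex set $A\cup B$, where $A$ and $B$ are two disjoint copies of $\mathbb N$, in which every pair $ab$ with $a\in A$, $b\in B$ is an edge with probability $p$, independently. $B(n,p)$ is obtained from $B(\mathbb N,p)$ by restricting $A$ and $B$ to their first $n$ elements, so all $B(n,p)$ live on one probability space. $\log$ is the natural logarithm, with the convention $\log 0=-\infty$. *)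

theory Defs
  imports "HOL-Probability.Probability"
begin

text \<open>A graph is given by a vertex set together with a set of edges, an edge being the set of
  its two endpoints.\<close>

definition perfect_matching :: "'v set \<Rightarrow> 'v set set \<Rightarrow> 'v set set \<Rightarrow> bool" where
  "perfect_matching V E M \<longleftrightarrow> M \<subseteq> E \<and> (\<forall>v\<in>V. \<exists>!e. e \<in> M \<and> v \<in> e)"

definition num_perfect_matchings :: "'v set \<Rightarrow> 'v set set \<Rightarrow> nat" where
  "num_perfect_matchings V E = card {M. perfect_matching V E M}"

definition induced_edges :: "'v set \<Rightarrow> 'v set set \<Rightarrow> 'v set set" where
  "induced_edges V E = {e \<in> E. e \<subseteq> V}"

text \<open>The two disjoint copies of the natural numbers are the two summands of \<open>nat + nat\<close>:
  \<open>A = range Inl\<close> and \<open>B = range Inr\<close>.\<close>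

type_synonym vertex = "nat + nat"

definition bip_edge :: "nat \<Rightarrow> nat \<Rightarrow> vertex set" where
  "bip_edge a b = {Inl a, Inr b}"

definition bip_vertices :: "nat \<Rightarrow> vertex set" where
  "bip_vertices n = Inl ` {..<n} \<union> Inr ` {..<n}"

text \<open>\<open>G\<close> is (the random edge set of) a copy of \<open>B(\<nat>,p)\<close>, living on an arbitrary probability
  space \<open>M\<close>.\<close>

locale random_bipartite_graph = prob_space M for M :: "'a measure" +
  fixes p :: real and G :: "'a \<Rightarrow> vertex set set"
  assumes bipartite: "\<And>\<omega>. \<omega> \<in> space M \<Longrightarrow> G \<omega> \<subseteq> {bip_edge a b | a b. True}"
    and indep_edges: "indep_events (\<lambda>(a, b). {\<omega> \<in> space M. bip_edge a b \<in> G \<omega>}) UNIV"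
    and prob_edge: "\<And>a b. prob {\<omega> \<in> space M. bip_edge a b \<in> G \<omega>} = p"

definition matching_count :: "('a \<Rightarrow> vertex set set) \<Rightarrow> nat \<Rightarrow> 'a \<Rightarrow> nat" where
  "matching_count G n \<omega> = num_perfect_matchings (bip_vertices n) (induced_edges (bip_vertices n) (G \<omega>))"

text \<open>The library has \<open>ln 0 = 0\<close> on the reals; here \<open>log 0 = -\<infinity>\<close> is needed.\<close>

definition log_ext :: "nat \<Rightarrow> ereal" where
  "log_ext k = (if k = 0 then -\<infinity> else ereal (ln (real k)))"

definition log_matching_count :: "('a \<Rightarrow> vertex set set) \<Rightarrow> nat \<Rightarrow> 'a \<Rightarrow> ereal" where
  "log_matching_count G n \<omega> = log_ext (matching_count G n \<omega>)"

text \<open>Such a graph exists: take the product of Bernoulli measures over all potential edges.\<close>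

lemma bip_edge_eq_iff [simp]: "bip_edge a b = bip_edge c d \<longleftrightarrow> a = c \<and> b = d"
  by (auto simp: bip_edge_def doubleton_eq_iff)

lemma random_bipartite_graph_product:
  assumes p: "0 \<le> p" "p \<le> 1"
  shows "random_bipartite_graph
    (PiM (UNIV :: (nat \<times> nat) set) (\<lambda>_. measure_pmf (bernoulli_pmf p))) p
    (\<lambda>\<omega>. {bip_edge a b | a b. \<omega> (a, b)})"
proof -
  define N where "N = (\<lambda>_ :: nat \<times> nat. measure_pmf (bernoulli_pmf p))"
  define P where "P = PiM UNIV N"
  interpret product_prob_space N UNIV
    by unfold_locales (auto simp: N_def measure_pmf.emeasure_space_1)
  interpret Q: prob_space P
    unfolding P_def by (rule prob_space_PiM) (simp add: N_def measure_pmf.prob_space_axioms)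
  have sp: "space P = UNIV"
    by (auto simp: P_def N_def space_PiM)
  have cyl: "Q.prob {\<omega>. \<forall>e\<in>J. \<omega> e} = p ^ card J" if "finite J" for J
  proof -
    have "emeasure P {\<omega> \<in> space P. \<forall>i\<in>J. \<omega> i \<in> {True}} = (\<Prod>i\<in>J. emeasure (N i) {True})"
      unfolding P_def using that by (intro emeasure_PiM_Collect) (auto simp: N_def)
    also have "\<dots> = ennreal (p ^ card J)"
      using p by (simp add: N_def emeasure_pmf_single ennreal_power)
    finally show ?thesis
      using p by (simp add: sp measure_def)
  qed
  have single: "Q.prob {\<omega>. \<omega> e} = p" for e
    using cyl[of "{e}"] by simp
  have meas: "{\<omega>. \<omega> e} \<in> Q.events" for e
  proof -
    have "{\<omega> \<in> space P. \<omega> e \<in> {True}} \<in> sets P"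
      unfolding P_def by (rule sets_Collect_single) (auto simp: N_def)
    then show ?thesis by (simp add: sp)
  qed
  have "Q.indep_events (\<lambda>e. {\<omega>. \<omega> e}) UNIV"
    unfolding Q.indep_events_def
  proof (intro conjI allI impI)
    fix J :: "(nat \<times> nat) set"
    assume J: "finite J"
    have "(\<Inter>e\<in>J. {\<omega>. \<omega> e}) = {\<omega>. \<forall>e\<in>J. \<omega> e}" by auto
    then show "Q.prob (\<Inter>e\<in>J. {\<omega>. \<omega> e}) = (\<Prod>e\<in>J. Q.prob {\<omega>. \<omega> e})"
      using cyl[OF J] by (simp add: single)
  qed (use meas in auto)
  moreover have "(\<lambda>(a, b). {\<omega> \<in> space P. bip_edge a b \<in> {bip_edge a b | a b. \<omega> (a, b)}})
      = (\<lambda>e. {\<omega>. \<omega> e})"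
    by (auto simp: sp fun_eq_iff)
  ultimately have "random_bipartite_graph P p (\<lambda>\<omega>. {bip_edge a b | a b. \<omega> (a, b)})"
    by unfold_locales (auto simp: sp single)
  then show ?thesis
    by (simp add: P_def N_def)
qed

end

theory Submission
  imports Defs "HOL-Real_Asymp.Real_Asymp"
begin

text \<open>Let \<open>\<eta>\<^sub>e = (1[e \<in> T] - p) / p\<close> be the normalised indicator of a cell \<open>e\<close> of the \<open>n \<times> n\<close> grid and
  \<open>\<chi>\<^sub>U = \<Prod>e\<in>U. \<eta>\<^sub>e\<close>. Then \<open>Z = X\<^sub>n / (n! p\<^sup>n) = \<Sum>U. c\<^sub>U \<chi>\<^sub>U\<close>, where \<open>c\<^sub>U\<close> is the proportion of permutations
  whose graph contains \<open>U\<close>, while \<open>E = \<Prod>e. (1 + \<eta>\<^sub>e / n) = \<Sum>U. n\<^bsup>-|U|\<^esup> \<chi>\<^sub>U\<close>. The coefficients nearly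
  agree: on level \<open>k\<close> their squared distance is \<open>O(k\<^sup>2 / (k! n))\<close>. A two-point hypercontractive
  inequality turns this into \<open>\<bbbE>(Z - E)\<^sup>4 = O(n\<^bsup>-2\<^esup>)\<close>, so that almost surely \<open>|Z - E| < n\<^bsup>-1/8\<^esup>\<close> for all
  large \<open>n\<close>. On the other hand \<open>ln E\<close> differs from \<open>S\<^sub>n / n\<close>, \<open>S\<^sub>n = \<Sum>e. \<eta>\<^sub>e\<close>, by a deterministic constant, and
  \<open>S\<^sub>n\<close> is a sum of \<open>n\<^sup>2\<close> bounded independent centred variables of variance \<open>(1 - p) / p\<close>. Since
  \<open>ln (ln (n\<^sup>2)) \<sim> ln (ln n)\<close>, the claim is the classical law of the iterated logarithm for \<open>S\<^sub>n\<close>: an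
  exponential maximal inequality along a geometric sequence gives the upper bound, and a change of
  measure from \<open>p\<close> to \<open>p + u\<close> with the second Borel-Cantelli lemma gives the lower bound.

  \<open>bexp p J F\<close> is the expectation of \<open>F\<close> over a random subset of \<open>J\<close> containing each element
  independently with probability \<open>p\<close>; every event depending on finitely many cells is measured by it.\<close>

subsection \<open>Random subsets\<close>

lemma sum_Pow_insert:
  assumes "finite J" "e \<notin> J"
  shows "(\<Sum>U\<in>Pow (insert e J). f U) = (\<Sum>U\<in>Pow J. f U) + (\<Sum>U\<in>Pow J. f (insert e U))"
proof -
  have "(\<Sum>U\<in>Pow (insert e J). f U) = (\<Sum>U\<in>Pow J. f U) + (\<Sum>U\<in>insert e ` Pow J. f U)"
    unfolding Pow_insert by (rule sum.union_disjoint) (use assms in auto)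
  also have "(\<Sum>U\<in>insert e ` Pow J. f U) = (\<Sum>U\<in>Pow J. f (insert e U))"
    by (subst sum.reindex) (use assms in \<open>auto simp: inj_on_def\<close>)
  finally show ?thesis .
qed

definition bexp :: "real \<Rightarrow> 'e set \<Rightarrow> ('e set \<Rightarrow> real) \<Rightarrow> real" where
  "bexp p J F = (\<Sum>T\<in>Pow J. p ^ card T * (1 - p) ^ card (J - T) * F T)"

lemma bexp_empty [simp]: "bexp p {} F = F {}"
  by (simp add: bexp_def)

text \<open>Conditions on whether \<open>e\<close> is chosen. Every later induction that adds one
  element to the ground set runs on this recursion.\<close>

lemma bexp_insert:
  assumes "finite J" "e \<notin> J"
  shows "bexp p (insert e J) F = p * bexp p J (\<lambda>T. F (insert e T)) + (1 - p) * bexp p J F"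
proof -
  let ?w = "\<lambda>T. p ^ card T * (1 - p) ^ card (insert e J - T) * F T"
  have "bexp p (insert e J) F = sum ?w (Pow J) + (\<Sum>T\<in>Pow J. ?w (insert e T))"
    unfolding bexp_def by (rule sum_Pow_insert[OF assms])
  also have "(\<Sum>T\<in>Pow J. ?w (insert e T)) = p * bexp p J (\<lambda>T. F (insert e T))"
    unfolding bexp_def sum_distrib_left
  proof (rule sum.cong[OF refl])
    fix T assume T: "T \<in> Pow J"
    then have "finite T" "e \<notin> T" "insert e J - insert e T = J - T"
      using assms finite_subset by auto
    then show "?w (insert e T)
        = p * (p ^ card T * (1 - p) ^ card (J - T) * F (insert e T))"
      by simp
  qed
  also have "sum ?w (Pow J) = (1 - p) * bexp p J F"
    unfolding bexp_def sum_distrib_left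
  proof (rule sum.cong[OF refl])
    fix T assume T: "T \<in> Pow J"
    then have "insert e J - T = insert e (J - T)" "finite (J - T)" "e \<notin> J - T"
      using assms by auto
    then show "?w T = (1 - p) * (p ^ card T * (1 - p) ^ card (J - T) * F T)"
      by simp
  qed
  finally show ?thesis by simp
qed

lemma bexp_cong:
  "(\<And>T. T \<subseteq> J \<Longrightarrow> F T = F' T) \<Longrightarrow> bexp p J F = bexp p J F'"
  by (auto simp: bexp_def intro!: sum.cong)

lemma bexp_add: "bexp p J (\<lambda>T. F T + F' T) = bexp p J F + bexp p J F'"
  by (simp add: bexp_def algebra_simps sum.distrib)

lemma bexp_cmult: "bexp p J (\<lambda>T. c * F T) = c * bexp p J F"
  by (simp add: bexp_def sum_distrib_left algebra_simps)

lemma bexp_const: "finite J \<Longrightarrow> bexp p J (\<lambda>_. c) = c"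
  by (induction J rule: finite_induct) (auto simp: bexp_insert algebra_simps)

lemma bexp_mono:
  assumes "0 \<le> p" "p \<le> 1" "\<And>T. T \<subseteq> J \<Longrightarrow> F T \<le> F' T"
  shows "bexp p J F \<le> bexp p J F'"
  unfolding bexp_def using assms by (intro sum_mono mult_left_mono) auto

lemma bexp_Un:
  assumes "finite J" "finite K" "J \<inter> K = {}"
  shows "bexp p (J \<union> K) F = bexp p J (\<lambda>T. bexp p K (\<lambda>U. F (T \<union> U)))"
  using assms(1,3)
proof (induction J arbitrary: F rule: finite_induct)
  case (insert e J)
  then show ?case
    using assms(2) by (simp add: bexp_insert)
qed simp

text \<open>The traces of the random set on disjoint ground sets are independent: after
  \<open>bexp_Un\<close> has split the expectation, the inner one pulls out as a constant.\<close>

lemma bexp_mult_disjoint: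
  assumes "finite J" "finite K" "J \<inter> K = {}"
  shows "bexp p (J \<union> K) (\<lambda>T. F (T \<inter> J) * F' (T \<inter> K)) = bexp p J F * bexp p K F'"
proof -
  have "bexp p (J \<union> K) (\<lambda>T. F (T \<inter> J) * F' (T \<inter> K)) = bexp p J (\<lambda>T. bexp p K F' * F T)"
    unfolding bexp_Un[OF assms]
  proof (rule bexp_cong)
    fix T assume T: "T \<subseteq> J"
    have "bexp p K (\<lambda>U. F ((T \<union> U) \<inter> J) * F' ((T \<union> U) \<inter> K)) = bexp p K (\<lambda>U. F T * F' U)"
    proof (rule bexp_cong)
      fix U assume U: "U \<subseteq> K"
      have "(T \<union> U) \<inter> J = T" "(T \<union> U) \<inter> K = U"
        using T U assms(3) by auto
      then show "F ((T \<union> U) \<inter> J) * F' ((T \<union> U) \<inter> K) = F T * F' U" by simp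
    qed
    then show "bexp p K (\<lambda>U. F ((T \<union> U) \<inter> J) * F' ((T \<union> U) \<inter> K)) = bexp p K F' * F T"
      by (simp add: bexp_cmult)
  qed
  then show ?thesis by (simp add: bexp_cmult)
qed

lemma bexp_restrict:
  assumes "finite K" "J \<subseteq> K"
  shows "bexp p K (\<lambda>T. F (T \<inter> J)) = bexp p J F"
proof -
  have "J \<union> (K - J) = K" using assms by auto
  then show ?thesis
    using bexp_mult_disjoint[of J "K - J" p F "\<lambda>_. 1"] assms finite_subset[OF assms(2,1)]
    by (simp add: bexp_const)
qed

lemma bexp_Cauchy_Schwarz:
  assumes "0 \<le> p" "p \<le> 1"
  shows "(bexp p J (\<lambda>T. F T * F' T))\<^sup>2 \<le> bexp p J (\<lambda>T. (F T)\<^sup>2) * bexp p J (\<lambda>T. (F' T)\<^sup>2)"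
proof -
  \<comment> \<open>Square roots of the point weights turn the weighted inequality into the plain
    one for finite sums.\<close>
  define w where "w T = sqrt (p ^ card T * (1 - p) ^ card (J - T))" for T
  have w: "p ^ card T * (1 - p) ^ card (J - T) = (w T)\<^sup>2" for T
    using assms by (simp add: w_def)
  show ?thesis
    using Cauchy_Schwarz_ineq_sum[of "\<lambda>T. w T * F T" "\<lambda>T. w T * F' T" "Pow J"]
    by (simp add: bexp_def w power_mult_distrib power2_eq_square algebra_simps)
qed

lemma bexp_Markov:
  assumes p: "0 \<le> p" "p \<le> 1" and t: "t > 0" and F: "\<And>T. T \<subseteq> J \<Longrightarrow> F T \<ge> 0"
  shows "bexp p J (\<lambda>T. of_bool (F T \<ge> t)) \<le> bexp p J F / t"
proof -
  have "bexp p J (\<lambda>T. of_bool (F T \<ge> t)) \<le> bexp p J (\<lambda>T. (1 / t) * F T)"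
    using t F by (intro bexp_mono p) (auto simp: field_simps)
  also have "\<dots> = bexp p J F / t" by (subst bexp_cmult) simp
  finally show ?thesis .
qed

section \<open>Events of the infinite graph that depend on finitely many cells\<close>

definition cells :: "vertex set set \<Rightarrow> (nat \<times> nat) set" where
  "cells E = {(a, b). bip_edge a b \<in> E}"

context random_bipartite_graph
begin

lemma cell_event [measurable]: "{\<omega> \<in> space M. e \<in> cells (G \<omega>)} \<in> events"
  using indep_edges unfolding indep_events_def
  by (cases e) (auto simp: cells_def image_subset_iff)

text \<open>Independence is given for the presence of edges only. Absence is brought in one cell at
  a time: \<open>T\<close> present with \<open>e\<close> and \<open>U\<close> absent is the event
  \<open>T\<close> present with \<open>U\<close> absent, minus the event that \<open>e\<close> is
  present as well. For this \<open>T\<close> has to stay arbitrary in the induction.\<close>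

lemma cells_present_absent:
  assumes "finite U" "finite T" "T \<inter> U = {}"
  shows "prob {\<omega> \<in> space M. T \<subseteq> cells (G \<omega>) \<and> U \<inter> cells (G \<omega>) = {}}
    = p ^ card T * (1 - p) ^ card U"
  using assms
proof (induction U arbitrary: T rule: finite_induct)
  case empty
  \<comment> \<open>The product formula in \<open>indep_events\<close> speaks of nonempty index sets
    only, so the empty intersection is treated separately.\<close>
  show ?case
  proof (cases "T = {}")
    case True
    then show ?thesis by (simp add: prob_space)
  next
    case False
    have "prob (\<Inter>e\<in>T. case e of (a, b) \<Rightarrow> {\<omega> \<in> space M. bip_edge a b \<in> G \<omega>})
        = (\<Prod>e\<in>T. prob (case e of (a, b) \<Rightarrow> {\<omega> \<in> space M. bip_edge a b \<in> G \<omega>}))"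
      using indep_edges empty False unfolding indep_events_def by blast
    also have "(\<Inter>e\<in>T. case e of (a, b) \<Rightarrow> {\<omega> \<in> space M. bip_edge a b \<in> G \<omega>})
        = {\<omega> \<in> space M. T \<subseteq> cells (G \<omega>)}"
      using False by (force simp: cells_def)
    also have "(\<Prod>e\<in>T. prob (case e of (a, b) \<Rightarrow> {\<omega> \<in> space M. bip_edge a b \<in> G \<omega>}))
        = p ^ card T"
      by (simp add: case_prod_unfold prob_edge)
    finally show ?thesis by simp
  qed
next
  case (insert e U)
  define A where "A T U = {\<omega> \<in> space M. T \<subseteq> cells (G \<omega>) \<and> U \<inter> cells (G \<omega>) = {}}" for T U
  have meas: "A T U \<in> events" if "finite T" "finite U" for T U
  proof -
    have "A T U = {\<omega> \<in> space M. (\<forall>e\<in>T. e \<in> cells (G \<omega>)) \<and> (\<forall>e\<in>U. \<not> e \<in> cells (G \<omega>))}"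
      by (auto simp: A_def)
    also have "\<dots> \<in> events"
      using that by measurable
    finally show ?thesis .
  qed
  have eq: "A T (insert e U) = A T U - A (insert e T) U"
    by (auto simp: A_def)
  have "prob (A T (insert e U)) = prob (A T U) - prob (A (insert e T) U)"
    unfolding eq using insert by (intro finite_measure_Diff meas) (auto simp: A_def)
  also have "\<dots> = p ^ card T * (1 - p) ^ card U - p ^ card (insert e T) * (1 - p) ^ card U"
    using insert.IH[of T] insert.IH[of "insert e T"] insert.hyps insert.prems by (simp add: A_def)
  also have "\<dots> = p ^ card T * (1 - p) ^ card (insert e U)"
    using insert by (auto simp: algebra_simps)
  finally show ?case by (simp add: A_def)
qed

lemma measurable_cells [measurable]:
  assumes "finite J"
  shows "(\<lambda>\<omega>. cells (G \<omega>) \<inter> J) \<in> measurable M (count_space (Pow J))"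
proof (subst measurable_count_space_eq2, use assms in simp, intro conjI ballI)
  show "(\<lambda>\<omega>. cells (G \<omega>) \<inter> J) \<in> space M \<rightarrow> Pow J" by auto
  fix T assume "T \<in> Pow J"
  then have "(\<lambda>\<omega>. cells (G \<omega>) \<inter> J) -` {T} \<inter> space M
      = {\<omega> \<in> space M. (\<forall>e\<in>J. (e \<in> cells (G \<omega>)) = (e \<in> T))}"
    by auto
  also have "\<dots> \<in> events" using assms by measurable
  finally show "(\<lambda>\<omega>. cells (G \<omega>) \<inter> J) -` {T} \<inter> space M \<in> events" .
qed

lemma measurable_cells_fun:
  fixes f :: "(nat \<times> nat) set \<Rightarrow> 'b"
  assumes "finite J"
  shows "(\<lambda>\<omega>. f (cells (G \<omega>) \<inter> J)) \<in> measurable M (count_space UNIV)"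
  using measurable_compose[OF measurable_cells[OF assms], of f "count_space UNIV"] by simp

lemma cells_event:
  assumes "finite J"
  shows "{\<omega> \<in> space M. P (cells (G \<omega>) \<inter> J)} \<in> events"
  using measurable_sets[OF measurable_cells_fun[OF assms, of P], of "{True}"]
  by (simp add: vimage_def Int_def conj_commute)

text \<open>The bridge from \<open>M\<close> to finite sums: the event is split by the exact trace
  \<open>T\<close> on \<open>J\<close>, whose probability is the point weight in
  \<open>bexp\<close>.\<close>

lemma prob_cells:
  assumes J: "finite J"
  shows "prob {\<omega> \<in> space M. P (cells (G \<omega>) \<inter> J)} = bexp p J (\<lambda>T. of_bool (P T))"
proof -
  have eq: "{\<omega> \<in> space M. P (cells (G \<omega>) \<inter> J)}
      = (\<Union>T\<in>{T \<in> Pow J. P T}. {\<omega> \<in> space M. cells (G \<omega>) \<inter> J = T})"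
    by auto
  have "prob {\<omega> \<in> space M. P (cells (G \<omega>) \<inter> J)}
      = (\<Sum>T\<in>{T \<in> Pow J. P T}. prob {\<omega> \<in> space M. cells (G \<omega>) \<inter> J = T})"
    unfolding eq using J cells_event[OF J]
    by (intro finite_measure_finite_Union) (auto simp: disjoint_family_on_def)
  also have "\<dots> = (\<Sum>T\<in>{T \<in> Pow J. P T}. p ^ card T * (1 - p) ^ card (J - T))"
  proof (rule sum.cong[OF refl])
    fix T assume "T \<in> {T \<in> Pow J. P T}"
    then have T: "T \<subseteq> J" "finite T" using J finite_subset by auto
    have "{\<omega> \<in> space M. cells (G \<omega>) \<inter> J = T}
        = {\<omega> \<in> space M. T \<subseteq> cells (G \<omega>) \<and> (J - T) \<inter> cells (G \<omega>) = {}}"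
      using T by auto
    then show "prob {\<omega> \<in> space M. cells (G \<omega>) \<inter> J = T} = p ^ card T * (1 - p) ^ card (J - T)"
      using cells_present_absent[of "J - T" T] J T by auto
  qed
  also have "\<dots> = bexp p J (\<lambda>T. of_bool (P T))"
    unfolding bexp_def using J by (subst sum.inter_filter) (simp_all add: of_bool_def if_distrib cong: if_cong)
  finally show ?thesis .
qed

end

subsection \<open>Perfect matchings as permutations\<close>

definition graph_on :: "nat \<Rightarrow> (nat \<Rightarrow> nat) \<Rightarrow> (nat \<times> nat) set" where
  "graph_on n \<sigma> = (\<lambda>i. (i, \<sigma> i)) ` {..<n}"

lemma bip_edge_mem_iff [simp]:
  "Inl x \<in> bip_edge a b \<longleftrightarrow> x = a" "Inr y \<in> bip_edge a b \<longleftrightarrow> y = b"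
  by (auto simp: bip_edge_def)

text \<open>The unique matching edge at each left vertex defines \<open>\<sigma>\<close>; uniqueness
  at the right vertices makes it injective, hence bijective on the finite set
  \<open>{..<n}\<close>.\<close>

lemma perfect_matching_permutation:
  assumes E: "E \<subseteq> {bip_edge a b | a b. True}"
    and pm: "perfect_matching (bip_vertices n) (induced_edges (bip_vertices n) E) M"
  obtains \<sigma> where "\<sigma> permutes {..<n}" "graph_on n \<sigma> \<subseteq> cells E"
    "M = (\<lambda>i. bip_edge i (\<sigma> i)) ` {..<n}"
proof -
  have ME: "\<exists>a b. e = bip_edge a b \<and> a < n \<and> b < n \<and> (a, b) \<in> cells E" if "e \<in> M" for e
  proof -
    have "e \<in> E" "e \<subseteq> bip_vertices n"
      using that pm by (auto simp: perfect_matching_def induced_edges_def)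
    moreover obtain a b where ab: "e = bip_edge a b" using \<open>e \<in> E\<close> E by auto
    ultimately have "Inl a \<in> bip_vertices n" "Inr b \<in> bip_vertices n" "(a, b) \<in> cells E"
      by (simp_all add: bip_edge_def cells_def)
    then show ?thesis
      using ab by (auto simp: bip_vertices_def)
  qed
  have uni: "\<exists>!e. e \<in> M \<and> v \<in> e" if "v \<in> bip_vertices n" for v
    using pm that by (auto simp: perfect_matching_def)
  have "\<exists>b. b < n \<and> bip_edge i b \<in> M" if "i < n" for i
    using uni[of "Inl i"] ME that by (force simp: bip_vertices_def)
  then obtain s where s: "\<And>i. i < n \<Longrightarrow> s i < n \<and> bip_edge i (s i) \<in> M" by metis
  \<comment> \<open>The identity outside \<open>{..<n}\<close>, as \<open>permutes\<close>
    demands.\<close>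
  define \<sigma> where "\<sigma> i = (if i < n then s i else i)" for i
  have inj: "inj_on \<sigma> {..<n}"
  proof (rule inj_onI)
    fix i j assume ij: "i \<in> {..<n}" "j \<in> {..<n}" "\<sigma> i = \<sigma> j"
    then have "bip_edge i (s i) \<in> M" "bip_edge j (s i) \<in> M" "Inr (s i) \<in> bip_vertices n"
      using s[of i] s[of j] by (auto simp: \<sigma>_def bip_vertices_def)
    then have "bip_edge i (s i) = bip_edge j (s i)"
      using uni[of "Inr (s i)"] bip_edge_mem_iff(2) by blast
    then show "i = j" by simp
  qed
  have "\<sigma> ` {..<n} = {..<n}"
    using inj s by (intro endo_inj_surj) (auto simp: \<sigma>_def)
  then have "\<sigma> permutes {..<n}"
    using inj by (intro bij_imp_permutes) (auto simp: bij_betw_def \<sigma>_def)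
  moreover have sub: "bip_edge i (\<sigma> i) \<in> M" if "i < n" for i
    using s that by (simp add: \<sigma>_def)
  then have "graph_on n \<sigma> \<subseteq> cells E"
    using ME by (fastforce simp: graph_on_def)
  moreover have "M \<subseteq> (\<lambda>i. bip_edge i (\<sigma> i)) ` {..<n}"
  proof
    fix e assume e: "e \<in> M"
    then obtain a b where ab: "e = bip_edge a b" "a < n" using ME by blast
    then have "Inl a \<in> e" "Inl a \<in> bip_edge a (\<sigma> a)" "Inl a \<in> bip_vertices n"
      by (auto simp: bip_vertices_def)
    then have "e = bip_edge a (\<sigma> a)"
      using uni[of "Inl a"] e sub[OF ab(2)] by blast
    then show "e \<in> (\<lambda>i. bip_edge i (\<sigma> i)) ` {..<n}" using ab by auto
  qed
  ultimately show thesis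
    using sub by (intro that[of \<sigma>]) auto
qed

lemma permutation_perfect_matching:
  assumes "\<sigma> permutes {..<n}" "graph_on n \<sigma> \<subseteq> cells E"
  shows "perfect_matching (bip_vertices n) (induced_edges (bip_vertices n) E)
    ((\<lambda>i. bip_edge i (\<sigma> i)) ` {..<n})"
  unfolding perfect_matching_def
proof (intro conjI ballI)
  have lt: "\<sigma> i < n" if "i < n" for i
    using permutes_in_image[OF assms(1)] that by auto
  show "(\<lambda>i. bip_edge i (\<sigma> i)) ` {..<n} \<subseteq> induced_edges (bip_vertices n) E"
    using assms(2) lt
    by (auto simp: graph_on_def cells_def induced_edges_def bip_vertices_def bip_edge_def)
  fix v assume "v \<in> bip_vertices n"
  then consider i where "v = Inl i" "i < n" | j where "v = Inr j" "j < n"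
    by (auto simp: bip_vertices_def)
  then show "\<exists>!e. e \<in> (\<lambda>i. bip_edge i (\<sigma> i)) ` {..<n} \<and> v \<in> e"
  proof cases
    case 1
    then show ?thesis by (intro ex1I[of _ "bip_edge i (\<sigma> i)"]) auto
  next
    case 2
    then have "j \<in> \<sigma> ` {..<n}"
      using permutes_image[OF assms(1)] by simp
    then obtain i where "i < n" "\<sigma> i = j" by auto
    show ?thesis
    proof (rule ex1I[of _ "bip_edge i (\<sigma> i)"])
      show "bip_edge i (\<sigma> i) \<in> (\<lambda>i. bip_edge i (\<sigma> i)) ` {..<n} \<and> v \<in> bip_edge i (\<sigma> i)"
        using \<open>i < n\<close> \<open>\<sigma> i = j\<close> 2 by (intro conjI imageI) simp_all
      fix e assume "e \<in> (\<lambda>i. bip_edge i (\<sigma> i)) ` {..<n} \<and> v \<in> e"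
      then obtain k where k: "e = bip_edge k (\<sigma> k)" "\<sigma> k = \<sigma> i"
        using 2 \<open>\<sigma> i = j\<close> by auto
      then show "e = bip_edge i (\<sigma> i)"
        using injD[OF permutes_inj[OF assms(1)] k(2)] by simp
    qed
  qed
qed

text \<open>So the matching count is the permanent of the first \<open>n\<close> rows and columns of
  the 0-1 matrix with support \<open>cells E\<close>. The map from permutations to matchings is a
  bijection, its surjectivity being \<open>perfect_matching_permutation\<close>.\<close>

lemma num_perfect_matchings_eq_permutations:
  assumes E: "E \<subseteq> {bip_edge a b | a b. True}"
  shows "num_perfect_matchings (bip_vertices n) (induced_edges (bip_vertices n) E)
    = card {\<sigma>. \<sigma> permutes {..<n} \<and> graph_on n \<sigma> \<subseteq> cells E}"
proof -
  let ?f = "\<lambda>\<sigma>. (\<lambda>i. bip_edge i (\<sigma> i)) ` {..<n}"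
  have "inj_on ?f {\<sigma>. \<sigma> permutes {..<n} \<and> graph_on n \<sigma> \<subseteq> cells E}"
  proof (rule inj_onI)
    fix \<sigma> \<tau> assume a: "\<sigma> \<in> {\<sigma>. \<sigma> permutes {..<n} \<and> graph_on n \<sigma> \<subseteq> cells E}"
      "\<tau> \<in> {\<sigma>. \<sigma> permutes {..<n} \<and> graph_on n \<sigma> \<subseteq> cells E}" and eq: "?f \<sigma> = ?f \<tau>"
    show "\<sigma> = \<tau>"
    proof
      fix i
      show "\<sigma> i = \<tau> i"
      proof (cases "i < n")
        case True
        then have "bip_edge i (\<sigma> i) \<in> ?f \<tau>" using eq by blast
        then show ?thesis by auto
      qed (use a in \<open>auto simp: permutes_def\<close>)
    qed
  qed
  then have "card (?f ` {\<sigma>. \<sigma> permutes {..<n} \<and> graph_on n \<sigma> \<subseteq> cells E})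
      = card {\<sigma>. \<sigma> permutes {..<n} \<and> graph_on n \<sigma> \<subseteq> cells E}"
    by (rule card_image)
  moreover have "?f ` {\<sigma>. \<sigma> permutes {..<n} \<and> graph_on n \<sigma> \<subseteq> cells E}
    = {M. perfect_matching (bip_vertices n) (induced_edges (bip_vertices n) E) M}" (is "?L = ?R")
  proof
    show "?L \<subseteq> ?R" using permutation_perfect_matching by auto
    show "?R \<subseteq> ?L"
    proof
      fix M assume "M \<in> ?R"
      then have "perfect_matching (bip_vertices n) (induced_edges (bip_vertices n) E) M" by simp
      then obtain \<sigma> where "\<sigma> permutes {..<n}" "graph_on n \<sigma> \<subseteq> cells E" "M = ?f \<sigma>"
        by (rule perfect_matching_permutation[OF E])
      then show "M \<in> ?L" by blast
    qed
  qed
  ultimately show ?thesis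
    unfolding num_perfect_matchings_def by simp
qed

subsection \<open>Permanents and products\<close>

text \<open>For \<open>0 < p < 1\<close> the two values are \<open>(1 - p) / p\<close> and
  \<open>-1\<close>, so the mean is zero and the second moment is \<open>(1 - p) / p\<close>.
  Dividing by \<open>p\<close> makes \<open>1 + eta p e T\<close> equal to
  \<open>of_bool (e \<in> T) / p\<close>.\<close>

definition eta :: "real \<Rightarrow> 'e \<Rightarrow> 'e set \<Rightarrow> real" where
  "eta p e T = (of_bool (e \<in> T) - p) / p"

definition chi :: "real \<Rightarrow> 'e set \<Rightarrow> 'e set \<Rightarrow> real" where
  "chi p U T = (\<Prod>e\<in>U. eta p e T)"

text \<open>The left side is the mean of \<open>(g + \<eta> h)^4\<close> for one normalised
  indicator \<open>\<eta>\<close>, the right side is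
  \<open>(g\<^sup>2 + B h\<^sup>2)\<^sup>2\<close> with \<open>B = 4 / p\<^sup>2\<close>. The term
  in \<open>g^3 h\<close> drops out because \<open>\<eta>\<close> has mean zero, and the term in
  \<open>g h^3\<close> is absorbed by its two neighbours.\<close>

lemma two_point_fourth_moment:
  fixes p g h :: real
  assumes p: "0 < p" "p < 1"
  shows "p * (g + (1 - p) / p * h) ^ 4 + (1 - p) * (g - h) ^ 4
    \<le> g ^ 4 + 2 * (4 / p\<^sup>2) * (g\<^sup>2 * h\<^sup>2) + (4 / p\<^sup>2)\<^sup>2 * h ^ 4"
proof -
  \<comment> \<open>In the odds \<open>q\<close> one has \<open>p = 1 / (1 + q)\<close>, so the
    expansion becomes a polynomial identity in \<open>q\<close>, \<open>g\<close> and
    \<open>h\<close>.\<close>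
  define q where "q = (1 - p) / p"
  have q: "q > 0" using p by (simp add: q_def)
  have pq: "p = 1 / (1 + q)" "1 - p = q / (1 + q)"
    using p by (simp_all add: q_def field_simps)
  have B: "4 / p\<^sup>2 = 4 * (1 + q)\<^sup>2"
    by (simp add: pq(1) power_divide)
  have id: "(1 + q) * (g ^ 4 + 6 * q * (g\<^sup>2 * h\<^sup>2) + 4 * (q * (q - 1)) * (g * h ^ 3)
      + q * (q\<^sup>2 - q + 1) * h ^ 4) = (g + q * h) ^ 4 + q * (g - h) ^ 4"
    by algebra
  have w: "p * x + (1 - p) * y = (x + q * y) / (1 + q)" for x y
    unfolding pq(2) by (simp add: pq(1) add_divide_distrib)
  have "p * (g + q * h) ^ 4 + (1 - p) * (g - h) ^ 4
      = g ^ 4 + 6 * q * (g\<^sup>2 * h\<^sup>2) + 4 * (q * (q - 1)) * (g * h ^ 3) + q * (q\<^sup>2 - q + 1) * h ^ 4"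
    unfolding w id[symmetric] using q by simp
  \<comment> \<open>Expanding this square bounds the term in \<open>g h^3\<close>, whose sign is
    unknown, by multiples of \<open>g\<^sup>2 h\<^sup>2\<close> and \<open>h^4\<close>.\<close>
  moreover have "2 * q * (g * h - (q - 1) * h\<^sup>2)\<^sup>2 \<ge> 0"
    using q by simp
  then have "4 * (q * (q - 1)) * (g * h ^ 3) \<le> 2 * q * (g\<^sup>2 * h\<^sup>2) + 2 * q * (q - 1)\<^sup>2 * h ^ 4"
    by (simp add: power2_eq_square power3_eq_cube power4_eq_xxxx algebra_simps)
  moreover have "8 * q * (g\<^sup>2 * h\<^sup>2) \<le> 2 * (4 * (1 + q)\<^sup>2) * (g\<^sup>2 * h\<^sup>2)"
  proof (rule mult_right_mono)
    show "8 * q \<le> 2 * (4 * (1 + q)\<^sup>2)"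
      using q by (simp add: power2_eq_square algebra_simps)
  qed simp
  moreover have "(q * (q\<^sup>2 - q + 1) + 2 * q * (q - 1)\<^sup>2) * h ^ 4 \<le> (4 * (1 + q)\<^sup>2)\<^sup>2 * h ^ 4"
  proof (rule mult_right_mono)
    have "(4 * (1 + q)\<^sup>2)\<^sup>2 - (q * (q\<^sup>2 - q + 1) + 2 * q * (q - 1)\<^sup>2)
        = 16 + 61 * q + 101 * q\<^sup>2 + 61 * q ^ 3 + 16 * q ^ 4"
      by algebra
    also have "\<dots> \<ge> 0" using q by simp
    finally show "q * (q\<^sup>2 - q + 1) + 2 * q * (q - 1)\<^sup>2 \<le> (4 * (1 + q)\<^sup>2)\<^sup>2" by simp
  qed simp
  ultimately show ?thesis
    unfolding B q_def[symmetric] by (simp add: algebra_simps)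
qed

text \<open>Induction on the cells. Separating the monomials that contain \<open>e\<close> writes
  the sum as \<open>g + \<eta>\<^sub>e h\<close> with \<open>g\<close> and \<open>h\<close> free of
  \<open>e\<close>. The two-point inequality integrates out \<open>e\<close>, Cauchy-Schwarz bounds
  the mixed term by \<open>G * H\<close>, and
  \<open>G\<^sup>2 + 2 B G H + B\<^sup>2 H\<^sup>2\<close> is again a perfect square.\<close>

lemma hypercontractivity:
  assumes p: "0 < p" "p < 1" and J: "finite J"
  shows "bexp p J (\<lambda>T. (\<Sum>U\<in>Pow J. a U * chi p U T) ^ 4)
    \<le> (\<Sum>U\<in>Pow J. (4 / p\<^sup>2) ^ card U * (a U)\<^sup>2)\<^sup>2"
  using J
proof (induction J arbitrary: a rule: finite_induct)
  case empty
  then show ?case by (simp add: chi_def)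
next
  case (insert e J)
  define B where "B = 4 / p\<^sup>2"
  have B: "B > 0" using p by (simp add: B_def)
  define g h where "g T = (\<Sum>U\<in>Pow J. a U * chi p U T)"
    and "h T = (\<Sum>U\<in>Pow J. a (insert e U) * chi p U T)" for T
  define G H where "G = (\<Sum>U\<in>Pow J. B ^ card U * (a U)\<^sup>2)"
    and "H = (\<Sum>U\<in>Pow J. B ^ card U * (a (insert e U))\<^sup>2)"
  have GH: "G \<ge> 0" "H \<ge> 0"
    using B by (auto simp: G_def H_def intro!: sum_nonneg)
  have Eg: "bexp p J (\<lambda>T. g T ^ 4) \<le> G\<^sup>2" and Eh: "bexp p J (\<lambda>T. h T ^ 4) \<le> H\<^sup>2"
    unfolding g_def h_def G_def H_def B_def by (rule insert.IH)+
  have chi: "chi p U (insert e T) = chi p U T"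
      "chi p (insert e U) (insert e T) = (1 - p) / p * chi p U T"
      "chi p (insert e U) T = - chi p U T" if "T \<subseteq> J" "U \<in> Pow J" for T U
  proof -
    have U: "finite U" "e \<notin> U" and T: "e \<notin> T"
      using that insert finite_subset by auto
    show 1: "chi p U (insert e T) = chi p U T"
      unfolding chi_def by (rule prod.cong) (use U in \<open>auto simp: eta_def\<close>)
    show "chi p (insert e U) (insert e T) = (1 - p) / p * chi p U T"
      using U 1 by (simp add: chi_def eta_def)
    show "chi p (insert e U) T = - chi p U T"
      using U T p by (simp add: chi_def eta_def)
  qed
  have f: "(\<Sum>U\<in>Pow (insert e J). a U * chi p U (insert e T)) = g T + (1 - p) / p * h T"
      "(\<Sum>U\<in>Pow (insert e J). a U * chi p U T) = g T - h T" if "T \<subseteq> J" for T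
    unfolding sum_Pow_insert[OF insert.hyps] g_def h_def
    using chi[OF that] by (simp_all add: sum_distrib_left sum_negf algebra_simps)
  have "bexp p (insert e J) (\<lambda>T. (\<Sum>U\<in>Pow (insert e J). a U * chi p U T) ^ 4)
      = bexp p J (\<lambda>T. p * (g T + (1 - p) / p * h T) ^ 4 + (1 - p) * (g T - h T) ^ 4)"
    unfolding bexp_insert[OF insert.hyps] bexp_add bexp_cmult
    by (intro arg_cong2[of _ _ _ _ "(+)"] arg_cong2[of _ _ _ _ "(*)"] bexp_cong refl) (simp_all add: f)
  also have "\<dots> \<le> bexp p J (\<lambda>T. g T ^ 4 + 2 * B * ((g T)\<^sup>2 * (h T)\<^sup>2) + B\<^sup>2 * h T ^ 4)"
    unfolding B_def using p by (intro bexp_mono two_point_fourth_moment) auto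
  also have "\<dots> = bexp p J (\<lambda>T. g T ^ 4) + 2 * B * bexp p J (\<lambda>T. (g T)\<^sup>2 * (h T)\<^sup>2)
      + B\<^sup>2 * bexp p J (\<lambda>T. h T ^ 4)"
    by (simp only: bexp_add bexp_cmult)
  also have "\<dots> \<le> G\<^sup>2 + 2 * B * (G * H) + B\<^sup>2 * H\<^sup>2"
  proof (intro add_mono mult_left_mono Eg Eh)
    have "(bexp p J (\<lambda>T. (g T)\<^sup>2 * (h T)\<^sup>2))\<^sup>2
        \<le> bexp p J (\<lambda>T. ((g T)\<^sup>2)\<^sup>2) * bexp p J (\<lambda>T. ((h T)\<^sup>2)\<^sup>2)"
      using p by (intro bexp_Cauchy_Schwarz) auto
    also have "\<dots> = bexp p J (\<lambda>T. g T ^ 4) * bexp p J (\<lambda>T. h T ^ 4)"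
      by simp
    also have "\<dots> \<le> G\<^sup>2 * H\<^sup>2"
    proof (intro mult_mono Eg Eh)
      have "bexp p J (\<lambda>_. 0) \<le> bexp p J (\<lambda>T. h T ^ 4)"
        using p by (intro bexp_mono) auto
      then show "0 \<le> bexp p J (\<lambda>T. h T ^ 4)" by (simp add: bexp_const insert.hyps)
    qed simp
    also have "G\<^sup>2 * H\<^sup>2 = (G * H)\<^sup>2" by (simp only: power_mult_distrib)
    finally show "bexp p J (\<lambda>T. (g T)\<^sup>2 * (h T)\<^sup>2) \<le> G * H"
      by (rule power2_le_imp_le) (rule mult_nonneg_nonneg[OF GH])
  qed (use B in auto)
  also have "\<dots> = (G + B * H)\<^sup>2" by algebra
  also have "G + B * H = (\<Sum>U\<in>Pow (insert e J). B ^ card U * (a U)\<^sup>2)"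
    unfolding sum_Pow_insert[OF insert.hyps] G_def H_def sum_distrib_left
  proof (intro arg_cong2[of _ _ _ _ "(+)"] sum.cong refl)
    fix U assume "U \<in> Pow J"
    then have "finite U" "e \<notin> U" using insert finite_subset by auto
    then show "B * (B ^ card U * (a (insert e U))\<^sup>2) = B ^ card (insert e U) * (a (insert e U))\<^sup>2"
      by simp
  qed
  finally show ?case by (simp add: B_def)
qed

section \<open>Coefficients of the permanent and of the product\<close>

definition sq :: "nat \<Rightarrow> (nat \<times> nat) set" where
  "sq n = {..<n} \<times> {..<n}"

lemma finite_sq [simp]: "finite (sq n)" and card_sq [simp]: "card (sq n) = n\<^sup>2"
  by (simp_all add: sq_def power2_eq_square)

lemma graph_on_permutes:
  assumes "\<sigma> permutes {..<n}"
  shows "graph_on n \<sigma> \<subseteq> sq n" "finite (graph_on n \<sigma>)" "card (graph_on n \<sigma>) = n"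
proof -
  show "graph_on n \<sigma> \<subseteq> sq n"
    using permutes_in_image[OF assms] by (auto simp: graph_on_def sq_def)
  show "finite (graph_on n \<sigma>)" by (simp add: graph_on_def)
  show "card (graph_on n \<sigma>) = n"
    unfolding graph_on_def by (subst card_image) (auto simp: inj_on_def)
qed

text \<open>Composing with the inverse of one fixed extension \<open>\<tau>\<close> maps all
  extensions injectively to permutations that fix the \<open>card U\<close> rows of
  \<open>U\<close>. There is only an inequality because \<open>U\<close> may lie in no permutation
  graph at all.\<close>

lemma card_permutations_extending:
  "card {\<sigma>. \<sigma> permutes {..<n} \<and> U \<subseteq> graph_on n \<sigma>} \<le> fact (n - card U)"
proof (cases "\<exists>\<tau>. \<tau> permutes {..<n} \<and> U \<subseteq> graph_on n \<tau>")
  case False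
  then have "{\<sigma>. \<sigma> permutes {..<n} \<and> U \<subseteq> graph_on n \<sigma>} = {}" by blast
  then show ?thesis by (metis card.empty le0)
next
  case True
  then obtain \<tau> where \<tau>: "\<tau> permutes {..<n}" "U \<subseteq> graph_on n \<tau>" by blast
  define I where "I = {i \<in> {..<n}. (i, \<tau> i) \<in> U}"
  have U: "U = (\<lambda>i. (i, \<tau> i)) ` I"
    using \<tau>(2) by (auto simp: I_def graph_on_def)
  have card_I: "card I = card U"
    unfolding U by (subst card_image) (auto simp: inj_on_def)
  have "card {\<sigma>. \<sigma> permutes {..<n} \<and> U \<subseteq> graph_on n \<sigma>} \<le> card {\<sigma>. \<sigma> permutes ({..<n} - I)}"
  proof (rule card_inj_on_le[of "\<lambda>\<sigma>. inv \<tau> \<circ> \<sigma>"])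
    show "inj_on (\<lambda>\<sigma>. inv \<tau> \<circ> \<sigma>) {\<sigma>. \<sigma> permutes {..<n} \<and> U \<subseteq> graph_on n \<sigma>}"
    proof (rule inj_onI)
      fix \<sigma> \<sigma>' assume "inv \<tau> \<circ> \<sigma> = inv \<tau> \<circ> \<sigma>'"
      then have "\<tau> \<circ> (inv \<tau> \<circ> \<sigma>) = \<tau> \<circ> (inv \<tau> \<circ> \<sigma>')" by simp
      then show "\<sigma> = \<sigma>'"
        by (simp add: o_assoc permutes_inv_o[OF \<tau>(1)])
    qed
    show "(\<lambda>\<sigma>. inv \<tau> \<circ> \<sigma>) ` {\<sigma>. \<sigma> permutes {..<n} \<and> U \<subseteq> graph_on n \<sigma>}
        \<subseteq> {\<sigma>. \<sigma> permutes ({..<n} - I)}"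
    proof safe
      fix \<sigma> assume \<sigma>: "\<sigma> permutes {..<n}" "U \<subseteq> graph_on n \<sigma>"
      have "inv \<tau> \<circ> \<sigma> permutes {..<n}"
        using \<sigma> \<tau> by (intro permutes_compose permutes_inv)
      then show "inv \<tau> \<circ> \<sigma> permutes ({..<n} - I)"
      proof (rule permutes_superset)
        fix i assume "i \<in> {..<n} - ({..<n} - I)"
        then have "(i, \<tau> i) \<in> U" by (auto simp: I_def)
        then have "\<sigma> i = \<tau> i" using \<sigma>(2) by (auto simp: graph_on_def)
        then show "(inv \<tau> \<circ> \<sigma>) i = i"
          by (simp add: permutes_inverses[OF \<tau>(1)])
      qed
    qed
    show "finite {\<sigma>. \<sigma> permutes ({..<n} - I)}" by (simp add: finite_permutations)
  qed
  also have "\<dots> = fact (n - card U)"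
  proof (rule card_permutations)
    have "I \<subseteq> {..<n}" by (auto simp: I_def)
    then show "card ({..<n} - I) = n - card U"
      by (simp add: card_Diff_subset finite_subset card_I)
  qed simp
  finally show ?thesis .
qed

text \<open>The coefficient \<open>c\<^sub>U\<close>: the probability that the graph of a uniform
  random permutation contains \<open>U\<close>.\<close>

definition incidence :: "nat \<Rightarrow> (nat \<times> nat) set \<Rightarrow> real" where
  "incidence n U = real (card {\<sigma>. \<sigma> permutes {..<n} \<and> U \<subseteq> graph_on n \<sigma>}) / fact n"

lemma incidence_sum:
  "incidence n U = (\<Sum>\<sigma> | \<sigma> permutes {..<n}. of_bool (U \<subseteq> graph_on n \<sigma>)) / fact n"
  by (simp add: incidence_def finite_permutations Int_def)

text \<open>Double counting: the graph of each permutation has \<open>n\<close> cells, hence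
  \<open>n choose k\<close> subsets of size \<open>k\<close>.\<close>

lemma sum_incidence:
  "(\<Sum>U | U \<subseteq> sq n \<and> card U = k. incidence n U) = real (n choose k)"
proof -
  have "(\<Sum>U | U \<subseteq> sq n \<and> card U = k. incidence n U)
      = (\<Sum>\<sigma> | \<sigma> permutes {..<n}. \<Sum>U | U \<subseteq> sq n \<and> card U = k. of_bool (U \<subseteq> graph_on n \<sigma>)) / fact n"
    unfolding incidence_sum sum_divide_distrib[symmetric] by (subst sum.swap) simp
  also have "(\<Sum>\<sigma> | \<sigma> permutes {..<n}. \<Sum>U | U \<subseteq> sq n \<and> card U = k. of_bool (U \<subseteq> graph_on n \<sigma>))
      = (\<Sum>\<sigma> | \<sigma> permutes {..<n}. real (n choose k))"
  proof (rule sum.cong[OF refl])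
    fix \<sigma> assume "\<sigma> \<in> {\<sigma>. \<sigma> permutes {..<n}}"
    then have g: "graph_on n \<sigma> \<subseteq> sq n" "finite (graph_on n \<sigma>)" "card (graph_on n \<sigma>) = n"
      using graph_on_permutes by auto
    have "{U. U \<subseteq> sq n \<and> card U = k} \<inter> {U. U \<subseteq> graph_on n \<sigma>} = {U. U \<subseteq> graph_on n \<sigma> \<and> card U = k}"
      using g by auto
    then show "(\<Sum>U | U \<subseteq> sq n \<and> card U = k. of_bool (U \<subseteq> graph_on n \<sigma>)) = real (n choose k)"
      using n_subsets[OF g(2), of k] g(3) by simp
  qed
  also have "\<dots> = fact n * real (n choose k)"
    by (simp add: card_permutations[OF refl])
  finally show ?thesis by simp
qed

text \<open>The ratio is the product of \<open>1 - j / n\<close> over \<open>j < k\<close>, a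
  falling factorial over a power. The factor added in the induction step costs at most
  \<open>k / n\<close>, and \<open>k\<^sup>2 + k \<le> (k + 1)\<^sup>2\<close>.\<close>

lemma falling_power_ge:
  assumes "n > 0"
  shows "1 - real k ^ 2 / real n \<le> fact k * real (n choose k) / real n ^ k
    \<and> fact k * real (n choose k) / real n ^ k \<le> 1"
proof (induction k)
  case (Suc k)
  define r where "r = fact k * real (n choose k) / real n ^ k"
  have r: "1 - real k ^ 2 / real n \<le> r" "r \<le> 1" "r \<ge> 0"
    using Suc by (auto simp: r_def)
  have "Suc k * (n choose Suc k) = (n choose k) * (n - k)"
    by (metis binomial_absorb_comp binomial_absorption mult.commute)
  then have c: "real (Suc k) * real (n choose Suc k) = real (n choose k) * real (n - k)"
    by (metis of_nat_mult)
  have eq: "fact (Suc k) * real (n choose Suc k) / real n ^ Suc k = r * (real (n - k) / real n)"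
  proof -
    have "fact (Suc k) * real (n choose Suc k) = fact k * (real (Suc k) * real (n choose Suc k))"
      by (simp add: algebra_simps)
    then have "fact (Suc k) * real (n choose Suc k) = fact k * (real (n choose k) * real (n - k))"
      by (simp only: c)
    then show ?thesis by (simp add: r_def mult_ac)
  qed
  have s: "real (n - k) / real n \<le> 1" "1 - real k / real n \<le> real (n - k) / real n"
  proof -
    show "real (n - k) / real n \<le> 1" using assms by simp
    have "(real n - real k) / real n \<le> real (n - k) / real n"
      by (intro divide_right_mono) auto
    then show "1 - real k / real n \<le> real (n - k) / real n"
      using assms by (simp add: diff_divide_distrib)
  qed
  have "r * (real (n - k) / real n) \<le> 1 * 1"
    using r s by (intro mult_mono) auto
  moreover have "r * (1 - real k / real n) \<le> r * (real (n - k) / real n)"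
    using r s by (intro mult_left_mono) auto
  moreover have "r * (real k / real n) \<le> 1 * (real k / real n)"
    using r by (intro mult_right_mono) auto
  moreover have "real k ^ 2 / real n + real k / real n \<le> real (Suc k) ^ 2 / real n"
    using assms by (simp add: field_simps power2_eq_square)
  ultimately show ?case
    unfolding eq using r by (simp add: algebra_simps)
qed simp

text \<open>Expand the square. Both sums of squares are at most \<open>1 / fact k\<close>, and the
  mixed sum is at least \<open>(1 - k\<^sup>2 / n) / fact k\<close>. The main terms cancel as
  \<open>1 - 2 + 1\<close>, which leaves twice the deficit of the mixed sum.\<close>

lemma level_variance:
  assumes n: "n > 0"
  shows "(\<Sum>U | U \<subseteq> sq n \<and> card U = k. (incidence n U - (1 / real n) ^ k)\<^sup>2)
    \<le> 2 * real k ^ 2 / (fact k * real n)"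
proof -
  let ?S = "{U. U \<subseteq> sq n \<and> card U = k}"
  have fin: "finite ?S" by simp
  have "(\<Sum>U\<in>?S. (incidence n U)\<^sup>2) \<le> 1 / fact k"
  proof (cases "k \<le> n")
    case True
    \<comment> \<open>One factor is bounded by its largest possible value, the other is summed by
      double counting.\<close>
    have "(\<Sum>U\<in>?S. (incidence n U)\<^sup>2) \<le> (\<Sum>U\<in>?S. fact (n - k) / fact n * incidence n U)"
    proof (rule sum_mono)
      fix U assume "U \<in> ?S"
      then have "real (card {\<sigma>. \<sigma> permutes {..<n} \<and> U \<subseteq> graph_on n \<sigma>}) \<le> real (fact (n - k))"
        using card_permutations_extending[of n U] by (intro of_nat_mono) blast
      then have "incidence n U \<le> fact (n - k) / fact n"
        unfolding incidence_def of_nat_fact by (rule divide_right_mono) simp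
      then show "(incidence n U)\<^sup>2 \<le> fact (n - k) / fact n * incidence n U"
        unfolding power2_eq_square by (intro mult_right_mono) (auto simp: incidence_def)
    qed
    also have "\<dots> = fact (n - k) / fact n * real (n choose k)"
      by (simp only: sum_distrib_left[symmetric] sum_incidence)
    also have "\<dots> = 1 / fact k"
      using True by (simp add: binomial_fact)
    finally show ?thesis .
  next
    case False
    have "incidence n U = 0" if "U \<in> ?S" for U
    proof -
      have "{\<sigma>. \<sigma> permutes {..<n} \<and> U \<subseteq> graph_on n \<sigma>} = {}"
        using that False graph_on_permutes by (auto dest!: card_mono[rotated])
      then show ?thesis unfolding incidence_def by (metis card.empty div_0 of_nat_0)
    qed
    then show ?thesis by simp
  qed
  moreover have "real (card ?S) * ((1 / real n) ^ k)\<^sup>2 \<le> 1 / fact k"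
  proof -
    have "card ?S = (n\<^sup>2 choose k)" using n_subsets[of "sq n" k] by simp
    moreover have "fact k * real (n\<^sup>2 choose k) / real (n\<^sup>2) ^ k \<le> 1"
      using falling_power_ge[of "n\<^sup>2" k] n by simp
    ultimately show ?thesis
      using n by (simp add: field_simps power_mult[symmetric] mult.commute)
  qed
  moreover have "(\<Sum>U\<in>?S. (incidence n U - (1 / real n) ^ k)\<^sup>2)
     = (\<Sum>U\<in>?S. (incidence n U)\<^sup>2) - 2 * (1 / real n) ^ k * (\<Sum>U\<in>?S. incidence n U)
       + real (card ?S) * ((1 / real n) ^ k)\<^sup>2"
    by (simp add: power2_diff sum.distrib sum_subtractf sum_distrib_left algebra_simps)
  moreover have "(1 / real n) ^ k * real (n choose k) \<ge> (1 - real k ^ 2 / real n) / fact k"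
    using falling_power_ge[OF n, of k] by (simp add: field_simps)
  ultimately have "(\<Sum>U\<in>?S. (incidence n U - (1 / real n) ^ k)\<^sup>2)
      \<le> 1 / fact k - 2 * ((1 - real k ^ 2 / real n) / fact k) + 1 / fact k"
    unfolding sum_incidence by linarith
  also have "\<dots> = 2 * real k ^ 2 / (fact k * real n)"
    using n by (simp add: field_simps)
  finally show ?thesis .
qed

text \<open>Group by \<open>card U = k\<close> and use \<open>k\<^sup>2 \<le> 4 ^ k\<close>; the
  factor \<open>1 / fact k\<close> from \<open>level_variance\<close> then yields a partial sum of
  the exponential series.\<close>

lemma weighted_variance:
  assumes n: "n > 0" and B: "B \<ge> 0"
  shows "(\<Sum>U\<in>Pow (sq n). B ^ card U * (incidence n U - (1 / real n) ^ card U)\<^sup>2)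
    \<le> 2 * exp (4 * B) / real n"
proof -
  let ?f = "\<lambda>U. B ^ card U * (incidence n U - (1 / real n) ^ card U)\<^sup>2"
  have "(\<Sum>U\<in>Pow (sq n). ?f U) = (\<Sum>k\<le>n\<^sup>2. \<Sum>U | U \<in> Pow (sq n) \<and> card U = k. ?f U)"
    by (rule sum.group[symmetric]) (auto dest: card_mono[OF finite_sq])
  also have "\<dots> = (\<Sum>k\<le>n\<^sup>2. B ^ k * (\<Sum>U | U \<subseteq> sq n \<and> card U = k. (incidence n U - (1 / real n) ^ k)\<^sup>2))"
    unfolding sum_distrib_left by (intro sum.cong) auto
  also have "\<dots> \<le> (\<Sum>k\<le>n\<^sup>2. (2 / real n) * ((4 * B) ^ k /\<^sub>R fact k))"
  proof (rule sum_mono)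
    fix k
    have "real k \<le> 2 ^ k" using of_nat_less_two_power[of k, where 'a = real] by simp
    then have "real k ^ 2 \<le> (2 ^ k) ^ 2" by (intro power_mono) auto
    also have "(2 ^ k) ^ 2 = ((2 :: real) ^ 2) ^ k" by (simp only: power_mult[symmetric] mult.commute)
    also have "\<dots> = 4 ^ k" by simp
    finally have k2: "real k ^ 2 \<le> 4 ^ k" .
    have "B ^ k * (\<Sum>U | U \<subseteq> sq n \<and> card U = k. (incidence n U - (1 / real n) ^ k)\<^sup>2)
        \<le> B ^ k * (2 * real k ^ 2 / (fact k * real n))"
      using B by (intro mult_left_mono level_variance n) auto
    also have "\<dots> \<le> B ^ k * (2 * 4 ^ k / (fact k * real n))"
      using B k2 by (intro mult_left_mono divide_right_mono) auto
    also have "\<dots> = (2 / real n) * ((4 * B) ^ k /\<^sub>R fact k)"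
      by (simp add: power_mult_distrib field_simps)
    finally show "B ^ k * (\<Sum>U | U \<subseteq> sq n \<and> card U = k. (incidence n U - (1 / real n) ^ k)\<^sup>2)
        \<le> (2 / real n) * ((4 * B) ^ k /\<^sub>R fact k)" .
  qed
  also have "\<dots> = (2 / real n) * (\<Sum>k\<le>n\<^sup>2. (4 * B) ^ k /\<^sub>R fact k)"
    by (simp only: sum_distrib_left)
  also have "\<dots> \<le> (2 / real n) * exp (4 * B)"
  proof (intro mult_left_mono)
    have "(\<lambda>k. (4 * B) ^ k /\<^sub>R fact k) sums exp (4 * B)" by (rule exp_converges)
    then show "(\<Sum>k\<le>n\<^sup>2. (4 * B) ^ k /\<^sub>R fact k) \<le> exp (4 * B)"
      using B sum_le_suminf[of "\<lambda>k. (4 * B) ^ k /\<^sub>R fact k" "{..n\<^sup>2}"]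
      by (simp add: sums_iff)
  qed simp
  finally show ?thesis by simp
qed

section \<open>Fourth moment of the difference and almost sure comparison\<close>

definition perm_ratio :: "real \<Rightarrow> nat \<Rightarrow> (nat \<times> nat) set \<Rightarrow> real" where
  "perm_ratio p n T = real (card {\<sigma>. \<sigma> permutes {..<n} \<and> graph_on n \<sigma> \<subseteq> T}) / (fact n * p ^ n)"

definition cell_prod :: "real \<Rightarrow> nat \<Rightarrow> (nat \<times> nat) set \<Rightarrow> real" where
  "cell_prod p n T = (\<Prod>e\<in>sq n. 1 + eta p e T / real n)"

lemma prod_one_plus:
  fixes f :: "'b \<Rightarrow> 'c::comm_semiring_1"
  assumes "finite A"
  shows "(\<Prod>x\<in>A. 1 + f x) = (\<Sum>U\<in>Pow A. \<Prod>x\<in>U. f x)"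
  using prod_add[OF assms, of f "\<lambda>_. 1"] by (simp add: add.commute)

text \<open>The product of \<open>1 + eta p e T\<close> over the graph of \<open>\<sigma>\<close> is
  \<open>of_bool (graph_on n \<sigma> \<subseteq> T) / p ^ n\<close>. Expanding it and exchanging
  the sums over \<open>\<sigma>\<close> and \<open>U\<close> collects the coefficients.\<close>

lemma perm_ratio_expansion:
  assumes p: "0 < p"
  shows "perm_ratio p n T = (\<Sum>U\<in>Pow (sq n). incidence n U * chi p U T)"
proof -
  have "of_bool (graph_on n \<sigma> \<subseteq> T) / p ^ n = (\<Sum>U\<in>Pow (sq n). of_bool (U \<subseteq> graph_on n \<sigma>) * chi p U T)"
    if "\<sigma> permutes {..<n}" for \<sigma>
  proof -
    note g = graph_on_permutes[OF that]
    have "(\<Prod>e\<in>graph_on n \<sigma>. 1 + eta p e T) = (\<Prod>e\<in>graph_on n \<sigma>. of_bool (e \<in> T) / p)"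
      using p by (intro prod.cong) (auto simp: eta_def field_simps)
    also have "\<dots> = (\<Prod>e\<in>graph_on n \<sigma>. of_bool (e \<in> T)) / p ^ n"
      using g by (simp add: prod_dividef)
    also have "(\<Prod>e\<in>graph_on n \<sigma>. of_bool (e \<in> T)) = (of_bool (graph_on n \<sigma> \<subseteq> T) :: real)"
      using g(2) by (auto intro!: prod.neutral simp: subset_iff)
    finally have "of_bool (graph_on n \<sigma> \<subseteq> T) / p ^ n = (\<Sum>U\<in>Pow (graph_on n \<sigma>). chi p U T)"
      using prod_one_plus[OF g(2), of "\<lambda>e. eta p e T"] by (simp add: chi_def)
    also have "\<dots> = (\<Sum>U\<in>Pow (sq n). if U \<subseteq> graph_on n \<sigma> then chi p U T else 0)"
      using g(1) by (subst sum.inter_filter[symmetric]) (auto intro!: sum.cong)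
    also have "\<dots> = (\<Sum>U\<in>Pow (sq n). of_bool (U \<subseteq> graph_on n \<sigma>) * chi p U T)"
      by (intro sum.cong) auto
    finally show ?thesis .
  qed
  then have "(\<Sum>\<sigma> | \<sigma> permutes {..<n}. of_bool (graph_on n \<sigma> \<subseteq> T) / p ^ n)
     = (\<Sum>\<sigma> | \<sigma> permutes {..<n}. \<Sum>U\<in>Pow (sq n). of_bool (U \<subseteq> graph_on n \<sigma>) * chi p U T)"
    by (intro sum.cong) auto
  also have "\<dots> = (\<Sum>U\<in>Pow (sq n). (\<Sum>\<sigma> | \<sigma> permutes {..<n}. of_bool (U \<subseteq> graph_on n \<sigma>)) * chi p U T)"
    by (subst sum.swap) (simp only: sum_distrib_right)
  also have "\<dots> = (\<Sum>U\<in>Pow (sq n). fact n * (incidence n U * chi p U T))"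
    unfolding incidence_sum by simp
  also have "\<dots> = fact n * (\<Sum>U\<in>Pow (sq n). incidence n U * chi p U T)"
    by (simp only: sum_distrib_left)
  also have "(\<Sum>\<sigma> | \<sigma> permutes {..<n}. of_bool (graph_on n \<sigma> \<subseteq> T) / p ^ n) = fact n * perm_ratio p n T"
    unfolding sum_divide_distrib[symmetric]
    by (simp add: perm_ratio_def finite_permutations Int_def)
  finally show ?thesis by simp
qed

lemma cell_prod_expansion:
  "cell_prod p n T = (\<Sum>U\<in>Pow (sq n). (1 / real n) ^ card U * chi p U T)"
proof -
  have "(\<Prod>e\<in>U. eta p e T / real n) = (1 / real n) ^ card U * chi p U T" for U
    by (simp add: chi_def prod_dividef power_one_over)
  then show ?thesis
    by (simp add: cell_prod_def prod_one_plus)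
qed

text \<open>Hypercontractivity applied to the difference of the two expansions, with
  \<open>B = 4 / p\<^sup>2\<close> in \<open>weighted_variance\<close>.\<close>

lemma fourth_moment_difference:
  assumes p: "0 < p" "p < 1" and n: "n > 0"
  shows "bexp p (sq n) (\<lambda>T. (perm_ratio p n T - cell_prod p n T) ^ 4)
    \<le> (2 * exp (16 / p\<^sup>2) / real n)\<^sup>2"
proof -
  have "perm_ratio p n T - cell_prod p n T
      = (\<Sum>U\<in>Pow (sq n). (incidence n U - (1 / real n) ^ card U) * chi p U T)" for T
    by (simp add: perm_ratio_expansion[OF p(1)] cell_prod_expansion sum_subtractf left_diff_distrib)
  then have "bexp p (sq n) (\<lambda>T. (perm_ratio p n T - cell_prod p n T) ^ 4)
      \<le> (\<Sum>U\<in>Pow (sq n). (4 / p\<^sup>2) ^ card U * (incidence n U - (1 / real n) ^ card U)\<^sup>2)\<^sup>2"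
    using hypercontractivity[OF p finite_sq] by simp
  also have "\<dots> \<le> (2 * exp (4 * (4 / p\<^sup>2)) / real n)\<^sup>2"
    using p by (intro power_mono weighted_variance n sum_nonneg) auto
  finally show ?thesis by simp
qed

text \<open>Markov for the fourth power: the threshold \<open>n powr (-1/8)\<close> becomes
  \<open>n powr (-1/2)\<close>, and a fourth moment of order \<open>n powr (-2)\<close> leaves the
  summable \<open>n powr (-3/2)\<close>. A second moment of order \<open>1 / n\<close> would not
  give a summable bound.\<close>

lemma deviation_probability:
  assumes p: "0 < p" "p < 1" and n: "n > 0"
  shows "bexp p (sq n) (\<lambda>T. of_bool (\<bar>perm_ratio p n T - cell_prod p n T\<bar> \<ge> real n powr (- 1/8)))
    \<le> (2 * exp (16 / p\<^sup>2))\<^sup>2 * real n powr (- 3/2)"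
proof -
  have "bexp p (sq n) (\<lambda>T. of_bool (\<bar>perm_ratio p n T - cell_prod p n T\<bar> \<ge> real n powr (- 1/8)))
      \<le> bexp p (sq n) (\<lambda>T. of_bool ((perm_ratio p n T - cell_prod p n T) ^ 4 \<ge> real n powr (- 1/2)))"
  proof (rule bexp_mono)
    fix T
    have "real n powr (- 1/2) \<le> (perm_ratio p n T - cell_prod p n T) ^ 4"
      if "real n powr (- 1/8) \<le> \<bar>perm_ratio p n T - cell_prod p n T\<bar>"
    proof -
      have "(real n powr (- 1/8)) ^ 4 \<le> \<bar>perm_ratio p n T - cell_prod p n T\<bar> ^ 4"
        using that by (intro power_mono) auto
      then show ?thesis using n by (simp add: powr_power)
    qed
    then show "of_bool (\<bar>perm_ratio p n T - cell_prod p n T\<bar> \<ge> real n powr (- 1/8))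
      \<le> (of_bool ((perm_ratio p n T - cell_prod p n T) ^ 4 \<ge> real n powr (- 1/2)) :: real)" by simp
  qed (use p in auto)
  also have "\<dots> \<le> bexp p (sq n) (\<lambda>T. (perm_ratio p n T - cell_prod p n T) ^ 4) / real n powr (- 1/2)"
    using p n by (intro bexp_Markov) auto
  also have "\<dots> \<le> (2 * exp (16 / p\<^sup>2) / real n)\<^sup>2 / real n powr (- 1/2)"
    by (intro divide_right_mono fourth_moment_difference p n) auto
  also have "\<dots> = (2 * exp (16 / p\<^sup>2))\<^sup>2 * (1 / (real n) ^ 2 / real n powr (- 1/2))"
    by (simp add: power_divide)
  also have "1 / (real n) ^ 2 / real n powr (- 1/2) = real n powr (- 3/2)"
  proof -
    have "1 / (real n) ^ 2 = real n powr (-2)"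
      using n by (simp add: powr_minus powr_numeral divide_inverse)
    then have "1 / (real n) ^ 2 / real n powr (- 1/2) = real n powr (-2) / real n powr (- 1/2)" by simp
    also have "\<dots> = real n powr (- 3/2)"
      unfolding powr_diff[symmetric] by simp
    finally show ?thesis .
  qed
  finally show ?thesis .
qed

context random_bipartite_graph
begin

lemma eventually_AE_cells:
  assumes fin: "\<And>n. finite (J n)"
    and summ: "summable (\<lambda>n. bexp p (J n) (\<lambda>T. of_bool (P n T)))"
  shows "AE \<omega> in M. \<forall>\<^sub>F n in sequentially. \<not> P n (cells (G \<omega>) \<inter> J n)"
proof -
  have "AE \<omega> in M. \<forall>\<^sub>F n in sequentially. \<omega> \<in> space M - {\<omega> \<in> space M. P n (cells (G \<omega>) \<inter> J n)}"
    using summ fin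
    by (intro borel_cantelli_AE1 cells_event) (auto simp: prob_cells emeasure_eq_measure)
  then show ?thesis
    by eventually_elim (auto elim: eventually_mono)
qed

lemma perm_ratio_cell_prod_AE:
  assumes p: "0 < p" "p < 1"
  shows "AE \<omega> in M. \<forall>\<^sub>F n in sequentially.
    \<bar>perm_ratio p n (cells (G \<omega>) \<inter> sq n) - cell_prod p n (cells (G \<omega>) \<inter> sq n)\<bar> < real n powr (- 1/8)"
proof -
  have "summable (\<lambda>n. (2 * exp (16 / p\<^sup>2))\<^sup>2 * real n powr (- 3/2))"
    by (intro summable_mult) (simp add: summable_real_powr_iff)
  then have "summable (\<lambda>n. bexp p (sq n) (\<lambda>T. of_bool
      (\<bar>perm_ratio p n T - cell_prod p n T\<bar> \<ge> real n powr (- 1/8))))"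
  proof (rule summable_comparison_test_ev[rotated])
    have nonneg: "bexp p (sq n) (\<lambda>T. of_bool (P T)) \<ge> 0" for n P
      using p by (auto simp: bexp_def intro!: sum_nonneg)
    show "\<forall>\<^sub>F n in sequentially. norm (bexp p (sq n) (\<lambda>T. of_bool
      (\<bar>perm_ratio p n T - cell_prod p n T\<bar> \<ge> real n powr (- 1/8))))
      \<le> (2 * exp (16 / p\<^sup>2))\<^sup>2 * real n powr (- 3/2)"
      using eventually_gt_at_top[of 0]
      by eventually_elim (use deviation_probability[OF p] nonneg in simp)
  qed
  then have "AE \<omega> in M. \<forall>\<^sub>F n in sequentially. \<not> (\<lambda>n T. \<bar>perm_ratio p n T - cell_prod p n T\<bar>
      \<ge> real n powr (- 1/8)) n (cells (G \<omega>) \<inter> sq n)"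
    by (intro eventually_AE_cells) auto
  then show ?thesis by (simp add: not_le)
qed

end

subsection \<open>The upper bound in the law of the iterated logarithm\<close>

definition ssum :: "real \<Rightarrow> 'e set \<Rightarrow> 'e set \<Rightarrow> real" where
  "ssum p J T = (\<Sum>e\<in>J. eta p e T)"

lemma ssum_Int [simp]: "ssum p J (T \<inter> J) = ssum p J T"
  unfolding ssum_def by (rule sum.cong) (auto simp: eta_def)

lemma ssum_Int_superset: "J \<subseteq> K \<Longrightarrow> ssum p J (T \<inter> K) = ssum p J T"
  unfolding ssum_def by (rule sum.cong) (auto simp: eta_def)

lemma ssum_Diff:
  "finite K \<Longrightarrow> J \<subseteq> K \<Longrightarrow> ssum p K T = ssum p J T + ssum p (K - J) T"
  unfolding ssum_def by (simp add: sum.subset_diff add.commute)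

text \<open>The moment generating function of one \<open>eta p e\<close> at
  \<open>x\<close>.\<close>

definition mgf :: "real \<Rightarrow> real \<Rightarrow> real" where
  "mgf p x = p * exp (x * ((1 - p) / p)) + (1 - p) * exp (- x)"

lemma bexp_exp_ssum:
  assumes p: "0 < p" and J: "finite J"
  shows "bexp p J (\<lambda>T. exp (x * ssum p J T)) = mgf p x ^ card J"
  using J
proof (induction J rule: finite_induct)
  case empty
  then show ?case by (simp add: ssum_def)
next
  case (insert e J)
  have 1: "ssum p (insert e J) (insert e T) = (1 - p) / p + ssum p J T"
    and 2: "ssum p (insert e J) T = - 1 + ssum p J T" if "T \<subseteq> J" for T
  proof -
    have "ssum p J (insert e T) = ssum p J T"
      unfolding ssum_def by (rule sum.cong) (use insert in \<open>auto simp: eta_def\<close>)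
    then show "ssum p (insert e J) (insert e T) = (1 - p) / p + ssum p J T"
      using insert by (simp add: ssum_def eta_def)
    show "ssum p (insert e J) T = - 1 + ssum p J T"
      using insert that p by (auto simp: ssum_def eta_def)
  qed
  have "bexp p J (\<lambda>T. exp (x * ssum p (insert e J) (insert e T)))
      = bexp p J (\<lambda>T. exp (x * ((1 - p) / p)) * exp (x * ssum p J T))"
    by (rule bexp_cong) (simp only: 1 distrib_left exp_add)
  moreover have "bexp p J (\<lambda>T. exp (x * ssum p (insert e J) T))
      = bexp p J (\<lambda>T. exp (- x) * exp (x * ssum p J T))"
    by (rule bexp_cong) (simp add: 2 right_diff_distrib exp_add[symmetric])
  ultimately have "bexp p (insert e J) (\<lambda>T. exp (x * ssum p (insert e J) T))
      = p * (exp (x * ((1 - p) / p)) * mgf p x ^ card J) + (1 - p) * (exp (- x) * mgf p x ^ card J)"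
    by (simp only: bexp_insert[OF insert.hyps] bexp_cmult insert.IH)
  also have "\<dots> = mgf p x ^ card (insert e J)"
    using insert by (simp add: mgf_def algebra_simps)
  finally show ?case .
qed

text \<open>The tangent bound \<open>1 + y \<le> exp y\<close> is averaged over the two values,
  which have mean zero. It makes the exponential of \<open>x\<close> times the sum a
  submartingale.\<close>

lemma mgf_ge_1:
  assumes "0 < p" "p < 1"
  shows "mgf p x \<ge> 1"
proof -
  have "p * (1 + x * ((1 - p) / p)) + (1 - p) * (1 + - x) \<le> mgf p x"
    unfolding mgf_def using assms by (intro add_mono mult_left_mono exp_ge_add_one_self) auto
  moreover have "p * (1 + x * ((1 - p) / p)) + (1 - p) * (1 + - x) = 1"
    using assms by (simp add: field_simps)
  ultimately show ?thesis by simp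
qed

text \<open>Taylor with Lagrange remainder; on \<open>[-1, 1]\<close> the coefficient of the
  remainder is at most \<open>3 / 6\<close>.\<close>

lemma exp_le_cubic:
  fixes y :: real
  assumes "\<bar>y\<bar> \<le> 1"
  shows "exp y \<le> 1 + y + y\<^sup>2 / 2 + \<bar>y\<bar> ^ 3"
proof -
  obtain t where t: "\<bar>t\<bar> \<le> \<bar>y\<bar>" "exp y = (\<Sum>m<3. y ^ m / fact m) + exp t / fact 3 * y ^ 3"
    using Maclaurin_exp_le[of y 3] by blast
  have "exp t \<le> exp 1" using t assms by (subst exp_le_cancel_iff) linarith
  then have "exp t \<le> 3"
    using exp_le by linarith
  then have "exp t / fact 3 \<le> 1"
    by (simp add: fact_numeral)
  then have "exp t / fact 3 * \<bar>y ^ 3\<bar> \<le> 1 * \<bar>y ^ 3\<bar>"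
    by (intro mult_right_mono) auto
  moreover have "exp t / fact 3 * y ^ 3 \<le> exp t / fact 3 * \<bar>y ^ 3\<bar>"
    by (intro mult_left_mono) auto
  moreover have "(\<Sum>m<3. y ^ m / fact m) = 1 + y + y\<^sup>2 / 2"
    by (simp add: numeral_3_eq_3 fact_numeral power2_eq_square)
  ultimately show ?thesis using t(2) by (simp add: power_abs)
qed

text \<open>The first-order terms cancel and the second moment is \<open>(1 - p) / p\<close>. Both
  values are at most \<open>1 / p\<close> in absolute value, which gives the cubic error.\<close>

lemma mgf_le:
  assumes p: "0 < p" "p < 1" and x: "\<bar>x\<bar> / p \<le> 1"
  shows "mgf p x \<le> exp (x\<^sup>2 * ((1 - p) / p) / 2 + \<bar>x\<bar> ^ 3 / p ^ 3)"
proof -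
  define q where "q = (1 - p) / p"
  have q: "q > 0" "q \<le> 1 / p" and pq: "p * q = 1 - p"
    using p by (auto simp: q_def field_simps)
  have xq: "\<bar>x * q\<bar> \<le> \<bar>x\<bar> / p"
    using q mult_left_mono[OF q(2), of "\<bar>x\<bar>"] by (simp add: abs_mult)
  then have xq': "\<bar>x * q\<bar> \<le> 1" using x by linarith
  have x1: "\<bar>- x\<bar> \<le> \<bar>x\<bar> / p"
    using p by (simp add: field_simps mult_left_le_one_le)
  define Y where "Y = (\<bar>x\<bar> / p) ^ 3"
  have "mgf p x \<le> p * (1 + x * q + (x * q)\<^sup>2 / 2 + \<bar>x * q\<bar> ^ 3)
      + (1 - p) * (1 + - x + (- x)\<^sup>2 / 2 + \<bar>- x\<bar> ^ 3)"
    unfolding mgf_def q_def[symmetric] using p x xq' x1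
    by (intro add_mono mult_left_mono exp_le_cubic) auto
  also have "\<dots> \<le> p * (1 + x * q + (x * q)\<^sup>2 / 2 + Y)
      + (1 - p) * (1 + - x + (- x)\<^sup>2 / 2 + Y)"
    unfolding Y_def using p xq x1 by (intro add_mono mult_left_mono power_mono order_refl) auto
  also have "\<dots> = 1 + x * (p * q - (1 - p)) + x\<^sup>2 * (p * q * q + (1 - p)) / 2 + Y"
    by (simp add: power2_eq_square field_simps)
  also have "p * q * q + (1 - p) = q"
    using pq by algebra
  also have "1 + x * (p * q - (1 - p)) + x\<^sup>2 * q / 2 + Y
      = 1 + (x\<^sup>2 * q / 2 + \<bar>x\<bar> ^ 3 / p ^ 3)"
    by (simp add: pq power_divide Y_def)
  also have "\<dots> \<le> exp (x\<^sup>2 * q / 2 + \<bar>x\<bar> ^ 3 / p ^ 3)"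
    by (rule exp_ge_add_one_self)
  finally show ?thesis by (simp add: q_def)
qed

text \<open>Doob's maximal inequality for the submartingale \<open>exp (x * ssum p (J m) T)\<close>,
  proved by induction on the number of steps.\<close>

lemma exponential_maximal_inequality:
  assumes p: "0 < p" "p < 1" and fin: "\<And>m. finite (J m)" and mono: "\<And>m. J m \<subseteq> J (Suc m)"
  shows "bexp p (J N) (\<lambda>T. of_bool (\<exists>m\<le>N. c \<le> x * ssum p (J m) T)) \<le> exp (- c) * mgf p x ^ card (J N)"
proof -
  define A where "A N T \<longleftrightarrow> (\<exists>m\<le>N. c \<le> x * ssum p (J m) T)" for N T
  have J_mono: "J m \<subseteq> J n" if "m \<le> n" for m n
    using mono that by (rule lift_Suc_mono_le)
  have A_Int: "A N (T \<inter> J N) = A N T" for N T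
    using J_mono by (auto simp: A_def ssum_Int_superset)
  \<comment> \<open>on the event that level \<open>c\<close> was reached, \<open>mgf p x \<ge> 1\<close> keeps the exponential moment above \<open>exp c\<close>\<close>
  have claim: "exp c * bexp p (J N) (\<lambda>T. of_bool (A N T))
      \<le> bexp p (J N) (\<lambda>T. of_bool (A N T) * exp (x * ssum p (J N) T))" for N
  proof (induction N)
    case 0
    have "bexp p (J 0) (\<lambda>T. exp c * of_bool (A 0 T))
      \<le> bexp p (J 0) (\<lambda>T. of_bool (A 0 T) * exp (x * ssum p (J 0) T))"
      using p by (intro bexp_mono) (auto simp: A_def)
    then show ?case by (simp add: bexp_cmult)
  next
    case (Suc N)
    define D where "D = J (Suc N) - J N"
    \<comment> \<open>Level \<open>c\<close> is reached at \<open>Suc N\<close> for the first time;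
      there the bound holds pointwise. On \<open>A N\<close> the increment over \<open>D\<close> is
      independent of the past and contributes the factor \<open>mgf p x ^ card D\<close>.\<close>
    define R where "R T \<longleftrightarrow> A (Suc N) T \<and> \<not> A N T" for T
    have D: "finite D" "J N \<inter> D = {}" "J N \<union> D = J (Suc N)"
      using fin mono by (auto simp: D_def)
    have split: "ssum p (J (Suc N)) T = ssum p (J N) T + ssum p D T" for T
      unfolding D_def by (rule ssum_Diff) (use fin mono in auto)
    have A: "of_bool (A (Suc N) T) = (of_bool (A N T) + of_bool (R T) :: real)" for T
      by (auto simp: R_def A_def le_Suc_eq)
    have AN: "bexp p (J (Suc N)) (\<lambda>T. of_bool (A N T)) = bexp p (J N) (\<lambda>T. of_bool (A N T))"
      using bexp_restrict[of "J (Suc N)" "J N" p "\<lambda>T. of_bool (A N T)"] fin mono by (simp add: A_Int)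
    have "exp c * bexp p (J (Suc N)) (\<lambda>T. of_bool (A (Suc N) T))
        = exp c * bexp p (J N) (\<lambda>T. of_bool (A N T)) + bexp p (J (Suc N)) (\<lambda>T. exp c * of_bool (R T))"
      unfolding A bexp_add AN bexp_cmult by (simp add: algebra_simps)
    also have "\<dots> \<le> bexp p (J N) (\<lambda>T. of_bool (A N T) * exp (x * ssum p (J N) T)) * mgf p x ^ card D
        + bexp p (J (Suc N)) (\<lambda>T. of_bool (R T) * exp (x * ssum p (J (Suc N)) T))"
    proof (rule add_mono)
      have "0 \<le> exp c * bexp p (J N) (\<lambda>T. of_bool (A N T))"
        using p by (auto simp: bexp_def intro!: mult_nonneg_nonneg sum_nonneg)
      then have "exp c * bexp p (J N) (\<lambda>T. of_bool (A N T)) * 1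
        \<le> bexp p (J N) (\<lambda>T. of_bool (A N T) * exp (x * ssum p (J N) T)) * mgf p x ^ card D"
        using Suc.IH mgf_ge_1[OF p, of x] by (intro mult_mono one_le_power) auto
      then show "exp c * bexp p (J N) (\<lambda>T. of_bool (A N T))
        \<le> bexp p (J N) (\<lambda>T. of_bool (A N T) * exp (x * ssum p (J N) T)) * mgf p x ^ card D"
        by simp
      show "bexp p (J (Suc N)) (\<lambda>T. exp c * of_bool (R T))
        \<le> bexp p (J (Suc N)) (\<lambda>T. of_bool (R T) * exp (x * ssum p (J (Suc N)) T))"
        using p by (intro bexp_mono) (auto simp: R_def A_def le_Suc_eq)
    qed
    also have "bexp p (J N) (\<lambda>T. of_bool (A N T) * exp (x * ssum p (J N) T)) * mgf p x ^ card D
        = bexp p (J (Suc N)) (\<lambda>T. (of_bool (A N (T \<inter> J N)) * exp (x * ssum p (J N) (T \<inter> J N)))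
            * exp (x * ssum p D (T \<inter> D)))"
      unfolding bexp_exp_ssum[OF p(1) D(1), symmetric] D(3)[symmetric]
      by (rule bexp_mult_disjoint[OF fin D(1,2), symmetric])
    also have "\<dots> = bexp p (J (Suc N)) (\<lambda>T. of_bool (A N T) * exp (x * ssum p (J (Suc N)) T))"
      by (simp add: A_Int split distrib_left exp_add mult.assoc)
    also have "\<dots> + bexp p (J (Suc N)) (\<lambda>T. of_bool (R T) * exp (x * ssum p (J (Suc N)) T))
        = bexp p (J (Suc N)) (\<lambda>T. of_bool (A (Suc N) T) * exp (x * ssum p (J (Suc N)) T))"
      unfolding A bexp_add[symmetric] by (simp add: algebra_simps)
    finally show ?case .
  qed
  have "exp c * bexp p (J N) (\<lambda>T. of_bool (A N T)) \<le> bexp p (J N) (\<lambda>T. exp (x * ssum p (J N) T))"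
    by (rule order_trans[OF claim bexp_mono]) (use p in auto)
  then show ?thesis
    by (simp add: bexp_exp_ssum[OF p(1) fin] A_def exp_minus field_simps)
qed

section \<open>Geometric blocks and the first Borel-Cantelli lemma\<close>

lemma sq_mono: "m \<le> n \<Longrightarrow> sq m \<subseteq> sq n"
  by (auto simp: sq_def)

text \<open>Block \<open>k\<close> consists of the \<open>n\<close> from \<open>exp (d * k)\<close>
  to \<open>exp (d * (k + 1))\<close>. The level is taken at the left end while the maximum runs up
  to the right end, which costs the factor \<open>exp (2 * d) = 1 + eps\<close> in the variance. The
  squared factor \<open>1 + eps\<close> of the level outweighs this and leaves the exponent
  \<open>1 + eps\<close>. The sign \<open>s\<close> covers both tails.\<close>

lemma lil_upper_block:
  assumes p: "0 < p" "p < 1" and s: "\<bar>s\<bar> = 1" and eps: "eps > 0" and d: "exp (2 * d) = 1 + eps"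
  shows "\<forall>\<^sub>F k in sequentially. bexp p (sq (nat \<lfloor>exp (d * (real k + 1))\<rfloor>))
     (\<lambda>T. of_bool (\<exists>m\<le>nat \<lfloor>exp (d * (real k + 1))\<rfloor>.
        (1 + eps) * exp (d * real k) * sqrt (2 * ((1 - p) / p) * ln (d * real k)) \<le> s * ssum p (sq m) T))
    \<le> exp 1 * (d * real k) powr (- (1 + eps))"
proof -
  define q where "q = (1 - p) / p"
  have q: "q > 0" using p by (simp add: q_def)
  have "exp (2 * d) > exp 0" using eps d by simp
  then have d0: "d > 0" by simp
  \<comment> \<open>The minimiser of
    \<open>- x * a + (1 + eps) * exp (d * k) ^ 2 * q * x\<^sup>2 / 2\<close> for the level
    \<open>a\<close> of the block. There the linear part is \<open>2 * (1 + eps) * l\<close> with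
    \<open>l = ln (d * k)\<close>, and the quadratic part is half of it.\<close>
  define x where "x k = sqrt (2 * ln (d * real k) / q) / exp (d * real k)" for k
  have "((\<lambda>k. sqrt (2 * ln (d * real k) / q) / exp (d * real k) / p) \<longlongrightarrow> 0) sequentially"
    using d0 q p by real_asymp
  then have ev1: "\<forall>\<^sub>F k in sequentially. x k / p < 1"
    unfolding x_def by (rule order_tendstoD) simp
  \<comment> \<open>The cubic error of the exponent tends to zero; it is bounded by 1 below and
    becomes the factor \<open>exp 1\<close>.\<close>
  have "((\<lambda>k. exp (d * real k) ^ 2 * (sqrt (2 * ln (d * real k) / q) / exp (d * real k)) ^ 3) \<longlongrightarrow> 0) sequentially"
    using d0 q p by real_asymp
  then have "((\<lambda>k. (exp d ^ 2 / p ^ 3) * (exp (d * real k) ^ 2 * x k ^ 3)) \<longlongrightarrow> (exp d ^ 2 / p ^ 3) * 0) sequentially"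
    unfolding x_def by (intro tendsto_mult tendsto_const)
  then have ev2: "\<forall>\<^sub>F k in sequentially. (exp d ^ 2 / p ^ 3) * (exp (d * real k) ^ 2 * x k ^ 3) < 1"
    by (rule order_tendstoD) simp
  have "filterlim (\<lambda>k. d * real k) at_top sequentially"
    using d0 by real_asymp
  then have ev3: "\<forall>\<^sub>F k in sequentially. d * real k \<ge> exp 1"
    by (simp add: filterlim_at_top)
  show ?thesis
    using ev1 ev2 ev3
  proof eventually_elim
    case (elim k)
    define l where "l = ln (d * real k)"
    define n where "n = nat \<lfloor>exp (d * (real k + 1))\<rfloor>"
    define a where "a = (1 + eps) * exp (d * real k) * sqrt (2 * q * l)"
    have dk: "d * real k > 0" using elim(3) exp_gt_zero[of 1] by linarith
    then have l: "l \<ge> 1"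
      unfolding l_def using elim(3) ln_ge_iff[of "d * real k" 1] by simp
    then have x: "x k > 0" using q by (simp add: x_def l_def)
    have sx: "\<bar>s * x k\<bar> = x k" using s x by (simp add: abs_mult)
    have n: "real n \<le> exp (d * (real k + 1))"
      unfolding n_def by simp
    have xa: "x k * a = 2 * (1 + eps) * l"
    proof -
      have "sqrt (2 * l / q) * sqrt (2 * q * l) = sqrt ((2 * l)\<^sup>2)"
        unfolding real_sqrt_mult[symmetric] using q by (simp add: power2_eq_square)
      also have "\<dots> = 2 * l" unfolding real_sqrt_abs using l by simp
      finally have e: "sqrt (2 * l / q) * sqrt (2 * q * l) = 2 * l" .
      have "x k * a = (1 + eps) * (sqrt (2 * l / q) * sqrt (2 * q * l))"
        unfolding x_def a_def l_def[symmetric] by simp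
      then show ?thesis unfolding e by simp
    qed
    have "bexp p (sq n) (\<lambda>T. of_bool (\<exists>m\<le>n. a \<le> s * ssum p (sq m) T))
        \<le> bexp p (sq n) (\<lambda>T. of_bool (\<exists>m\<le>n. x k * a \<le> (s * x k) * ssum p (sq m) T))"
    proof (rule bexp_mono)
      fix T
      have "x k * a \<le> (s * x k) * ssum p (sq m) T" if "a \<le> s * ssum p (sq m) T" for m
        using mult_left_mono[OF that, of "x k"] x by (simp add: mult_ac)
      then show "of_bool (\<exists>m\<le>n. a \<le> s * ssum p (sq m) T)
        \<le> (of_bool (\<exists>m\<le>n. x k * a \<le> (s * x k) * ssum p (sq m) T) :: real)" by auto
    qed (use p in auto)
    also have "\<dots> \<le> exp (- (x k * a)) * mgf p (s * x k) ^ card (sq n)"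
      by (rule exponential_maximal_inequality[OF p]) (simp_all add: sq_mono)
    also have "\<dots> \<le> exp (- (x k * a)) * exp ((x k)\<^sup>2 * q / 2 + x k ^ 3 / p ^ 3) ^ card (sq n)"
      using mgf_le[OF p, of "s * x k"] mgf_ge_1[OF p, of "s * x k"] elim(1) s
      unfolding sx q_def[symmetric] by (intro mult_left_mono power_mono) (auto simp: power_mult_distrib power2_abs[of s, symmetric])
    also have "\<dots> = exp (- (x k * a) + real n ^ 2 * ((x k)\<^sup>2 * q / 2 + x k ^ 3 / p ^ 3))"
      unfolding card_sq exp_of_nat_mult[symmetric] exp_add[symmetric] of_nat_power by (rule refl)
    also have "\<dots> \<le> exp (- (x k * a) + exp (d * (real k + 1)) ^ 2 * ((x k)\<^sup>2 * q / 2 + x k ^ 3 / p ^ 3))"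
      using n x q p by (subst exp_le_cancel_iff) (intro add_left_mono mult_right_mono power_mono, auto)
    also have "exp (d * (real k + 1)) ^ 2 * ((x k)\<^sup>2 * q / 2 + x k ^ 3 / p ^ 3)
        = (1 + eps) * l + (exp d ^ 2 / p ^ 3) * (exp (d * real k) ^ 2 * x k ^ 3)"
    proof -
      have e: "exp (d * (real k + 1)) = exp d * exp (d * real k)"
        by (simp add: exp_add[symmetric] algebra_simps)
      have "exp (d * real k) ^ 2 * ((x k)\<^sup>2 * q / 2) = (exp (d * real k) * x k)\<^sup>2 * q / 2"
        by (simp add: power_mult_distrib)
      also have "exp (d * real k) * x k = sqrt (2 * l / q)"
        by (simp add: x_def l_def)
      also have "(sqrt (2 * l / q))\<^sup>2 * q / 2 = l"
        using q l by simp
      finally have el: "exp (d * real k) ^ 2 * ((x k)\<^sup>2 * q / 2) = l" .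
      have ed: "exp d ^ 2 = 1 + eps"
        using d by (simp add: power2_eq_square exp_add[symmetric])
      have "(exp d * exp (d * real k)) ^ 2 * ((x k)\<^sup>2 * q / 2 + x k ^ 3 / p ^ 3)
          = exp d ^ 2 * (exp (d * real k) ^ 2 * ((x k)\<^sup>2 * q / 2))
            + (exp d ^ 2 / p ^ 3) * (exp (d * real k) ^ 2 * x k ^ 3)"
        by (simp add: power_mult_distrib distrib_left mult.assoc)
      then show ?thesis
        unfolding e el by (simp only: ed)
    qed
    also have "exp (- (x k * a) + ((1 + eps) * l + (exp d ^ 2 / p ^ 3) * (exp (d * real k) ^ 2 * x k ^ 3)))
        \<le> exp (1 + - (1 + eps) * l)"
    proof -
      have "- (2 * (1 + eps) * l) + ((1 + eps) * l + z) \<le> 1 + - (1 + eps) * l" if "z < 1" for z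
        using that by (simp add: algebra_simps)
      from this[OF elim(2)] show ?thesis unfolding exp_le_cancel_iff xa .
    qed
    also have "\<dots> = exp 1 * (d * real k) powr (- (1 + eps))"
    proof -
      have "d * real k \<noteq> 0" using dk by linarith
      then show ?thesis by (simp only: exp_add powr_def l_def if_False)
    qed
    finally show ?case
      unfolding a_def n_def l_def q_def by simp
  qed
qed

context random_bipartite_graph
begin

definition S :: "'a \<Rightarrow> nat \<Rightarrow> real" where
  "S \<omega> n = ssum p (sq n) (cells (G \<omega>))"

text \<open>Borel-Cantelli over the blocks, whose bounds are multiples of the summable
  \<open>k powr (- (1 + eps))\<close>. The case \<open>s = -1\<close> serves the lower bound as
  well.\<close>

lemma lil_upper:
  assumes p: "0 < p" "p < 1" and s: "\<bar>s\<bar> = 1" and eps: "eps > 0"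
  shows "AE \<omega> in M. \<forall>\<^sub>F n in sequentially.
    s * S \<omega> n \<le> (1 + eps) * real n * sqrt (2 * ((1 - p) / p) * ln (ln (real n)))"
proof -
  define d where "d = ln (1 + eps) / 2"
  have d: "exp (2 * d) = 1 + eps" and d0: "d > 0"
    using eps by (simp_all add: d_def)
  define N where "N k = nat \<lfloor>exp (d * (real k + 1))\<rfloor>" for k
  define q where "q = (1 - p) / p"
  have q: "q > 0" using p by (simp add: q_def)
  define a where "a k = (1 + eps) * exp (d * real k) * sqrt (2 * q * ln (d * real k))" for k
  define P where "P k T \<longleftrightarrow> (\<exists>m\<le>N k. a k \<le> s * ssum p (sq m) T)" for k T
  have "summable (\<lambda>k. bexp p (sq (N k)) (\<lambda>T. of_bool (P k T)))"
  proof (rule summable_comparison_test_ev)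
    have "summable (\<lambda>k. exp 1 * d powr (- (1 + eps)) * real k powr (- (1 + eps)))"
      using eps by (intro summable_mult) (simp add: summable_real_powr_iff)
    then show "summable (\<lambda>k. exp 1 * (d * real k) powr (- (1 + eps)))"
      using d0 by (simp add: powr_mult mult_ac)
    have nonneg: "bexp p (sq (N k)) (\<lambda>T. of_bool (P k T)) \<ge> 0" for k
      using p by (auto simp: bexp_def intro!: sum_nonneg)
    show "\<forall>\<^sub>F k in sequentially. norm (bexp p (sq (N k)) (\<lambda>T. of_bool (P k T)))
        \<le> exp 1 * (d * real k) powr (- (1 + eps))"
      using lil_upper_block[OF p s eps d]
      by eventually_elim (use nonneg in \<open>simp add: P_def N_def a_def q_def\<close>)
  qed
  then have "AE \<omega> in M. \<forall>\<^sub>F k in sequentially. \<not> P k (cells (G \<omega>) \<inter> sq (N k))"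
    by (intro eventually_AE_cells) auto
  then show ?thesis
  proof eventually_elim
    case (elim \<omega>)
    have "filterlim (\<lambda>n. nat \<lfloor>ln (real n) / d\<rfloor>) at_top sequentially"
      using d0 by real_asymp
    then have ev1: "\<forall>\<^sub>F n in sequentially. \<not> P (nat \<lfloor>ln (real n) / d\<rfloor>) (cells (G \<omega>) \<inter> sq (N (nat \<lfloor>ln (real n) / d\<rfloor>)))"
      using elim by (rule eventually_compose_filterlim[rotated])
    have "filterlim (\<lambda>n. ln (real n)) at_top sequentially" by real_asymp
    then have ev2: "\<forall>\<^sub>F n in sequentially. ln (real n) \<ge> 1 + 2 * d"
      by (simp add: filterlim_at_top)
    have ev3: "\<forall>\<^sub>F n in sequentially. n > 0" by (rule eventually_gt_at_top)
    show "\<forall>\<^sub>F n in sequentially.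
      s * S \<omega> n \<le> (1 + eps) * real n * sqrt (2 * ((1 - p) / p) * ln (ln (real n)))"
      using ev1 ev2 ev3
    proof eventually_elim
      case (elim n)
      \<comment> \<open>The block that contains \<open>n\<close>, so that
        \<open>exp (d * k) \<le> n \<le> exp (d * (k + 1))\<close>. The normalisation increases with
        \<open>n\<close>, hence it is at least its value at the left end.\<close>
      define k where "k = nat \<lfloor>ln (real n) / d\<rfloor>"
      have "real k \<le> ln (real n) / d" "ln (real n) / d < real k + 1"
        using elim(2) d0 by (auto simp: k_def)
      then have k: "d * real k \<le> ln (real n)" "ln (real n) < d * (real k + 1)"
        using d0 by (simp_all add: field_simps)
      have dk: "d * real k > 1" using k elim(2) d0 by (simp add: algebra_simps)
      have "real n = exp (ln (real n))" using elim(3) by simp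
      then have n1: "exp (d * real k) \<le> real n" and n2: "real n \<le> exp (d * (real k + 1))"
        using k by (metis exp_le_cancel_iff less_imp_le)+
      have nN: "n \<le> N k"
        using n2 by (simp add: N_def le_nat_iff le_floor_iff)
      have "\<not> a k \<le> s * ssum p (sq n) (cells (G \<omega>) \<inter> sq (N k))"
        using elim(1) nN unfolding P_def k_def[symmetric] by blast
      then have "s * S \<omega> n < a k"
        using nN by (simp add: S_def ssum_Int_superset sq_mono)
      also have "a k \<le> (1 + eps) * real n * sqrt (2 * q * ln (ln (real n)))"
        unfolding a_def using eps n1 k dk q
        by (intro mult_mono real_sqrt_le_mono mult_left_mono order_refl) auto
      finally show ?case by (simp add: q_def)
    qed
  qed
qed

end

subsection \<open>The lower bound in the law of the iterated logarithm\<close>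

lemma variance_card:
  assumes "finite J"
  shows "bexp p J (\<lambda>T. (real (card T) - p * real (card J))\<^sup>2) = real (card J) * (p * (1 - p))"
  using assms
proof (induction J rule: finite_induct)
  case (insert e J)
  define X where "X T = real (card T) - p * real (card J)" for T :: "'a set"
  have "bexp p J (\<lambda>T. (real (card (insert e T)) - p * real (card (insert e J)))\<^sup>2)
      = bexp p J (\<lambda>T. (X T + (1 - p))\<^sup>2)"
  proof (rule bexp_cong)
    fix T assume "T \<subseteq> J"
    then have "finite T" "e \<notin> T" using insert finite_subset by auto
    then show "(real (card (insert e T)) - p * real (card (insert e J)))\<^sup>2 = (X T + (1 - p))\<^sup>2"
      using insert by (simp add: X_def algebra_simps)
  qed
  moreover have "bexp p J (\<lambda>T. (real (card T) - p * real (card (insert e J)))\<^sup>2)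
      = bexp p J (\<lambda>T. (X T - p)\<^sup>2)"
    by (rule bexp_cong) (use insert in \<open>simp add: X_def algebra_simps\<close>)
  ultimately have "bexp p (insert e J) (\<lambda>T. (real (card T) - p * real (card (insert e J)))\<^sup>2)
      = bexp p J (\<lambda>T. p * (X T + (1 - p))\<^sup>2 + (1 - p) * (X T - p)\<^sup>2)"
    by (simp only: bexp_insert[OF insert.hyps] bexp_add bexp_cmult)
  also have "(\<lambda>T. p * (X T + (1 - p))\<^sup>2 + (1 - p) * (X T - p)\<^sup>2) = (\<lambda>T. (X T)\<^sup>2 + p * (1 - p))"
    by (rule ext) algebra
  also have "bexp p J (\<lambda>T. (X T)\<^sup>2 + p * (1 - p)) = real (card J) * (p * (1 - p)) + p * (1 - p)"
    using insert by (simp add: bexp_add bexp_const X_def)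
  also have "\<dots> = real (card (insert e J)) * (p * (1 - p))"
    using insert by (simp add: algebra_simps)
  finally show ?case .
qed simp

text \<open>Chebyshev: the variance is \<open>p * (1 - p) \<le> 1/4\<close> per element, so
  \<open>sqrt (card J)\<close> is at least two standard deviations.\<close>

lemma card_concentration:
  assumes p: "0 \<le> p" "p \<le> 1" and J: "finite J" "card J > 0"
  shows "bexp p J (\<lambda>T. of_bool (\<bar>real (card T) - p * real (card J)\<bar> < sqrt (real (card J)))) \<ge> 3/4"
proof -
  have "bexp p J (\<lambda>T. of_bool ((real (card T) - p * real (card J))\<^sup>2 \<ge> real (card J)))
      \<le> bexp p J (\<lambda>T. (real (card T) - p * real (card J))\<^sup>2) / real (card J)"
    using p J by (intro bexp_Markov) auto
  also have "\<dots> = p * (1 - p)"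
    using J by (simp add: variance_card card_gt_0_iff)
  also have "\<dots> \<le> 1/4"
    using zero_le_power2[of "p - 1/2"] by (simp add: power2_eq_square algebra_simps)
  finally have 1: "bexp p J (\<lambda>T. of_bool ((real (card T) - p * real (card J))\<^sup>2 \<ge> real (card J))) \<le> 1/4" .
  have "1 = bexp p J (\<lambda>T. of_bool (\<bar>real (card T) - p * real (card J)\<bar> < sqrt (real (card J)))
      + of_bool ((real (card T) - p * real (card J))\<^sup>2 \<ge> real (card J)))"
  proof -
    have "\<bar>y\<bar> < sqrt (real (card J)) \<longleftrightarrow> \<not> real (card J) \<le> y\<^sup>2" for y
      by (metis not_le real_sqrt_abs real_sqrt_le_iff)
    then have "of_bool (\<bar>y\<bar> < sqrt (real (card J))) + of_bool (real (card J) \<le> y\<^sup>2) = (1 :: real)" for y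
      by simp
    then show ?thesis using J by (simp add: bexp_const)
  qed
  then show ?thesis using 1 unfolding bexp_add by linarith
qed

text \<open>Relative entropy of the Bernoulli law with parameter \<open>p + u\<close> with respect
  to the one with parameter \<open>p\<close>.\<close>

definition KL :: "real \<Rightarrow> real \<Rightarrow> real" where
  "KL p u = (p + u) * ln (1 + u / p) + (1 - p - u) * ln (1 - u / (1 - p))"

text \<open>Change of measure. Under parameter \<open>p + u\<close> the size is within
  \<open>sqrt N\<close> of its mean with probability at least 3/4, and on that event the density
  with respect to parameter \<open>p\<close> is at most
  \<open>exp (N * KL p u + sqrt N * \<Lambda>)\<close>.\<close>

lemma tilting_lower_bound:
  assumes p: "0 < p" "p < 1" and u: "0 < u" "p + u < 1" and J: "finite J" "card J > 0"
  defines "N \<equiv> real (card J)"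
  shows "bexp p J (\<lambda>T. of_bool (real (card T) \<ge> (p + u) * N - sqrt N))
    \<ge> 3/4 * exp (- (N * KL p u + sqrt N * (ln (1 + u / p) - ln (1 - u / (1 - p)))))"
proof -
  define r where "r = p + u"
  define \<Lambda> where "\<Lambda> = ln (1 + u / p) - ln (1 - u / (1 - p))"
  have r: "0 < r" "r < 1" using p u by (auto simp: r_def)
  have pos: "1 + u / p > 0" "1 - u / (1 - p) > 0"
    using p u by (auto simp: field_simps intro: add_pos_pos)
  have "ln (1 - u / (1 - p)) \<le> ln (1 + u / p)"
  proof (subst ln_le_cancel_iff)
    have "u / p \<ge> 0" "u / (1 - p) \<ge> 0" using p u by auto
    then show "1 - u / (1 - p) \<le> 1 + u / p" by linarith
  qed (use pos in auto)
  then have \<Lambda>: "\<Lambda> \<ge> 0" by (simp add: \<Lambda>_def)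
  have ratio: "r = p * (1 + u / p)" "1 - r = (1 - p) * (1 - u / (1 - p))"
    using p by (auto simp: r_def field_simps)
  have "exp (- (N * KL p u + sqrt N * \<Lambda>)) * (3/4)
      \<le> exp (- (N * KL p u + sqrt N * \<Lambda>)) * bexp r J (\<lambda>T. of_bool (\<bar>real (card T) - r * N\<bar> < sqrt N))"
    unfolding N_def using r J by (intro mult_left_mono card_concentration) auto
  also have "\<dots> \<le> bexp p J (\<lambda>T. of_bool (real (card T) \<ge> r * N - sqrt N))"
    unfolding bexp_def sum_distrib_left
  proof (rule sum_mono)
    fix T assume "T \<in> Pow J"
    then have T: "T \<subseteq> J" "finite T" using J finite_subset by auto
    define t where "t = real (card T)"
    have "card T \<le> card J" using T J by (simp add: card_mono)
    then have Nt: "real (card (J - T)) = N - t"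
      using T by (simp add: N_def t_def card_Diff_subset)
    show "exp (- (N * KL p u + sqrt N * \<Lambda>)) * (r ^ card T * (1 - r) ^ card (J - T)
          * of_bool (\<bar>real (card T) - r * N\<bar> < sqrt N))
        \<le> p ^ card T * (1 - p) ^ card (J - T) * of_bool (real (card T) \<ge> r * N - sqrt N)"
    proof (cases "\<bar>t - r * N\<bar> < sqrt N")
      case True
      have "(1 + u / p) ^ card T * (1 - u / (1 - p)) ^ card (J - T)
          = exp (t * ln (1 + u / p) + (N - t) * ln (1 - u / (1 - p)))"
      proof -
        have "(1 + u / p) ^ card T = exp (t * ln (1 + u / p))"
          using pos by (simp add: t_def exp_of_nat_mult)
        moreover have "(1 - u / (1 - p)) ^ card (J - T) = exp ((N - t) * ln (1 - u / (1 - p)))"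
          unfolding Nt[symmetric] exp_of_nat_mult using pos by simp
        ultimately show ?thesis by (simp only: exp_add)
      qed
      \<comment> \<open>The log-density is affine in \<open>t\<close>, with slope
        \<open>\<Lambda>\<close> and value \<open>N * KL p u\<close> at the mean
        \<open>r * N\<close>.\<close>
      also have "t * ln (1 + u / p) + (N - t) * ln (1 - u / (1 - p)) = N * KL p u + (t - r * N) * \<Lambda>"
        unfolding KL_def \<Lambda>_def r_def by algebra
      also have "\<dots> \<le> N * KL p u + sqrt N * \<Lambda>"
        using True \<Lambda> by (intro add_left_mono mult_right_mono) auto
      finally have le: "(1 + u / p) ^ card T * (1 - u / (1 - p)) ^ card (J - T)
          \<le> exp (N * KL p u + sqrt N * \<Lambda>)" by simp
      have "exp (- y) * x \<le> 1" if "x \<le> exp y" for x y :: real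
        using mult_left_mono[OF that, of "exp (- y)"] by (simp add: exp_add[symmetric])
      note this[OF le]
      then have "p ^ card T * (1 - p) ^ card (J - T) * (exp (- (N * KL p u + sqrt N * \<Lambda>))
            * ((1 + u / p) ^ card T * (1 - u / (1 - p)) ^ card (J - T)))
          \<le> p ^ card T * (1 - p) ^ card (J - T) * 1"
        using p by (intro mult_left_mono) auto
      moreover have "r ^ card T * (1 - r) ^ card (J - T)
          = p ^ card T * (1 - p) ^ card (J - T) * ((1 + u / p) ^ card T * (1 - u / (1 - p)) ^ card (J - T))"
        unfolding ratio(2) unfolding ratio(1) power_mult_distrib by (simp add: mult_ac)
      ultimately show ?thesis
        using True by (simp add: t_def mult_ac abs_less_iff)
    next
      case False
      then show ?thesis using p by (simp add: t_def)
    qed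
  qed
  finally show ?thesis by (simp add: r_def \<Lambda>_def mult.commute)
qed

text \<open>Taylor at 0: to leading order the entropy is \<open>u\<^sup>2 / (2 p (1 - p))\<close>
  and the slope of the log-density is \<open>u / (p (1 - p))\<close>, so any larger constant works
  for small \<open>u\<close>.\<close>

lemma KL_eventually_le:
  assumes p: "0 < p" "p < 1" and eps: "eps > 0"
  shows "\<forall>\<^sub>F u in at_right 0. KL p u \<le> (1 + eps) * u\<^sup>2 / (2 * (p * (1 - p)))"
    and "\<forall>\<^sub>F u in at_right 0. ln (1 + u / p) - ln (1 - u / (1 - p)) \<le> 2 * u / (p * (1 - p))"
proof -
  define r where "r = 1 - p"
  have r: "r > 0" and pr: "p + r = 1" using p by (auto simp: r_def)
  have "((\<lambda>u. ((p + u) * ln (1 + u / p) + (r - u) * ln (1 - u / r)) / u\<^sup>2) \<longlongrightarrow> 1 / (2 * p) + 1 / (2 * r)) (at_right 0)"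
    using p(1) r by (real_asymp simp: field_simps)
  moreover have "1 / (2 * p) + 1 / (2 * r) = 1 / (2 * (p * r))"
    using p(1) r pr by (simp add: field_simps)
  moreover have "1 / (2 * (p * r)) < (1 + eps) / (2 * (p * r))"
    using p(1) r eps by (intro divide_strict_right_mono) auto
  ultimately have "\<forall>\<^sub>F u in at_right 0.
      ((p + u) * ln (1 + u / p) + (r - u) * ln (1 - u / r)) / u\<^sup>2 < (1 + eps) / (2 * (p * r))"
    by (intro order_tendstoD(2)) auto
  moreover have pos: "\<forall>\<^sub>F u in at_right 0. (u :: real) > 0"
    by (rule eventually_at_right_less)
  ultimately show "\<forall>\<^sub>F u in at_right 0. KL p u \<le> (1 + eps) * u\<^sup>2 / (2 * (p * (1 - p)))"
    unfolding r_def KL_def by eventually_elim (simp add: divide_less_eq)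
  have "((\<lambda>u. (ln (1 + u / p) - ln (1 - u / r)) / u) \<longlongrightarrow> 1 / p + 1 / r) (at_right 0)"
    using p(1) r by (real_asymp simp: field_simps)
  moreover have "1 / p + 1 / r = 1 / (p * r)"
    using p(1) r pr by (simp add: field_simps)
  moreover have "1 / (p * r) < 2 / (p * r)"
    using p(1) r by (intro divide_strict_right_mono) auto
  ultimately have "\<forall>\<^sub>F u in at_right 0. (ln (1 + u / p) - ln (1 - u / r)) / u < 2 / (p * r)"
    by (intro order_tendstoD(2)) auto
  then show "\<forall>\<^sub>F u in at_right 0. ln (1 + u / p) - ln (1 - u / (1 - p)) \<le> 2 * u / (p * (1 - p))"
    unfolding r_def using pos by eventually_elim (simp add: divide_less_eq)
qed

lemma ssum_card:
  assumes "finite J" "T \<subseteq> J"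
  shows "ssum p J T = (real (card T) - p * real (card J)) / p"
proof -
  have "J \<inter> T = T" using assms by auto
  then show ?thesis
    using assms by (simp add: ssum_def eta_def sum_divide_distrib[symmetric] sum_subtractf mult.commute)
qed

text \<open>Tilting by \<open>u = w k / sqrt N\<close> costs an exponent bounded in terms of
  \<open>k\<close> alone, eventually at most \<open>ln k\<close>. The bound is therefore uniform in
  \<open>J\<close> and of the order of the harmonic series.\<close>

lemma lil_lower_block:
  assumes p: "0 < p" "p < 1" and eps: "0 < eps" "eps < 1"
  shows "\<exists>k0. \<forall>k\<ge>k0. \<forall>J :: 'e set. finite J \<longrightarrow> card J \<ge> k \<longrightarrow>
    3 / 4 / real k \<le> bexp p J (\<lambda>T. of_bool
      (ssum p J T \<ge> (1 - eps) * sqrt (2 * ((1 - p) / p) * real (card J) * ln (real k))))"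
proof -
  define v where "v = p * (1 - p)"
  have v: "v > 0" using p by (simp add: v_def)
  define c where "c = (1 - eps) * sqrt 2 * sqrt v"
  have c: "c > 0" "c\<^sup>2 = 2 * v * (1 - eps)\<^sup>2"
    using v eps by (simp_all add: c_def power_mult_distrib)
  \<comment> \<open>The summand \<open>1\<close> pays for the \<open>sqrt N\<close> lost in
    \<open>tilting_lower_bound\<close>, and \<open>c\<close> is such that
    \<open>c * sqrt (ln k) * sqrt N / p\<close> is the required level.\<close>
  define w where "w k = c * sqrt (ln (real k)) + 1" for k :: nat
  obtain u0 where u0: "u0 > 0"
    and KL: "\<And>u. 0 < u \<Longrightarrow> u < u0 \<Longrightarrow> KL p u \<le> (1 + eps) * u\<^sup>2 / (2 * v)"
    and L: "\<And>u. 0 < u \<Longrightarrow> u < u0 \<Longrightarrow> ln (1 + u / p) - ln (1 - u / (1 - p)) \<le> 2 * u / v"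
    using eventually_conj[OF KL_eventually_le[OF p eps(1)]]
    unfolding eventually_at_right_field v_def by auto
  have "((\<lambda>k. (c * sqrt (ln (real k)) + 1) / sqrt (real k)) \<longlongrightarrow> 0) sequentially"
    using c(1) by real_asymp
  then have ev1: "\<forall>\<^sub>F k in sequentially. w k / sqrt (real k) < min u0 (1 - p)"
    unfolding w_def using u0 p by (intro order_tendstoD) auto
  \<comment> \<open>The leading constant of the exponent relative to \<open>ln k\<close>; being
    strictly below 1 it leaves room for the lower-order terms.\<close>
  have "(1 + eps) * (1 - eps)\<^sup>2 < 1"
  proof -
    have "(1 + eps) * (1 - eps)\<^sup>2 = (1 - eps\<^sup>2) * (1 - eps)" by algebra
    also have "\<dots> \<le> 1 * (1 - eps)" using eps by (intro mult_right_mono) auto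
    also have "\<dots> < 1" using eps by simp
    finally show ?thesis .
  qed
  moreover have "((\<lambda>k. ((1 + eps) * (c * sqrt (ln (real k)) + 1)\<^sup>2 / (2 * v)
      + 2 * (c * sqrt (ln (real k)) + 1) / v) / ln (real k))
      \<longlongrightarrow> (1 + eps) * c\<^sup>2 / (2 * v)) sequentially"
    using v eps c(1) by (real_asymp simp: field_simps power2_eq_square)
  moreover have "(1 + eps) * c\<^sup>2 / (2 * v) = (1 + eps) * (1 - eps)\<^sup>2"
    using v by (simp add: c(2))
  ultimately have ev2: "\<forall>\<^sub>F k in sequentially. ((1 + eps) * (w k)\<^sup>2 / (2 * v) + 2 * w k / v) / ln (real k) < 1"
    unfolding w_def by (intro order_tendstoD(2)) simp_all
  have "\<forall>\<^sub>F k in sequentially. \<forall>J :: 'e set. finite J \<longrightarrow> card J \<ge> k \<longrightarrow>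
    3 / 4 / real k \<le> bexp p J (\<lambda>T. of_bool
      (ssum p J T \<ge> (1 - eps) * sqrt (2 * ((1 - p) / p) * real (card J) * ln (real k))))"
    using ev1 ev2 eventually_gt_at_top[of 1]
  proof eventually_elim
    case (elim k)
    have lnk: "ln (real k) > 0" using elim(3) by simp
    have w: "w k > 0" unfolding w_def using c(1) lnk by (intro add_nonneg_pos) auto
    show ?case
    proof (intro allI impI)
      fix J :: "'e set" assume J: "finite J" "card J \<ge> k"
      define N where "N = real (card J)"
      have N: "N \<ge> real k" "N > 0" "card J > 0" using J elim(3) by (auto simp: N_def)
      define u where "u = w k / sqrt N"
      have "u \<le> w k / sqrt (real k)"
        unfolding u_def using w N elim(3) by (intro divide_left_mono) auto
      then have u: "0 < u" "u < u0" "p + u < 1"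
        using elim(1) w N by (auto simp: u_def)
      have "N * KL p u \<le> N * ((1 + eps) * u\<^sup>2 / (2 * v))"
        using KL[OF u(1,2)] N by (intro mult_left_mono) auto
      also have "\<dots> = (1 + eps) * (w k)\<^sup>2 / (2 * v)"
        using N by (simp add: u_def power_divide)
      finally have 1: "N * KL p u \<le> (1 + eps) * (w k)\<^sup>2 / (2 * v)" .
      have "sqrt N * (ln (1 + u / p) - ln (1 - u / (1 - p))) \<le> sqrt N * (2 * u / v)"
        using L[OF u(1,2)] N by (intro mult_left_mono) auto
      also have "\<dots> = 2 * w k / v" using N by (simp add: u_def)
      finally have 2: "sqrt N * (ln (1 + u / p) - ln (1 - u / (1 - p))) \<le> 2 * w k / v" .
      have "(1 + eps) * (w k)\<^sup>2 / (2 * v) + 2 * w k / v \<le> ln (real k)"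
        using elim(2) lnk by (simp add: divide_less_eq)
      with 1 2 have "exp (- ln (real k)) \<le> exp (- (N * KL p u + sqrt N * (ln (1 + u / p) - ln (1 - u / (1 - p)))))"
        by (subst exp_le_cancel_iff) linarith
      moreover have "exp (- ln (real k)) = 1 / real k"
        using elim(3) by (simp add: exp_minus inverse_eq_divide)
      ultimately have "3 / 4 / real k
          \<le> 3/4 * exp (- (N * KL p u + sqrt N * (ln (1 + u / p) - ln (1 - u / (1 - p)))))"
        by linarith
      also have "\<dots> \<le> bexp p J (\<lambda>T. of_bool (real (card T) \<ge> (p + u) * N - sqrt N))"
        unfolding N_def using tilting_lower_bound[OF p u(1,3) J(1) N(3)] .
      also have "\<dots> \<le> bexp p J (\<lambda>T. of_bool
          (ssum p J T \<ge> (1 - eps) * sqrt (2 * ((1 - p) / p) * real (card J) * ln (real k))))"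
      proof (rule bexp_mono)
        fix T assume T: "T \<subseteq> J"
        have "(1 - eps) * sqrt (2 * ((1 - p) / p) * real (card J) * ln (real k)) \<le> ssum p J T"
          if "real (card T) \<ge> (p + u) * N - sqrt N"
        proof -
          have "u * N = w k * sqrt N"
            using N real_div_sqrt[of N] by (simp add: u_def flip: times_divide_eq_right)
          then have "(1 - eps) * (sqrt (2 * ln (real k)) * sqrt v * sqrt N) \<le> real (card T) - p * N"
            using that by (simp add: w_def c_def real_sqrt_mult algebra_simps)
          moreover have "sqrt (2 * ln (real k)) * sqrt v * sqrt N
              = p * sqrt (2 * ((1 - p) / p) * real (card J) * ln (real k))"
          proof -
            have "p * sqrt (2 * ((1 - p) / p) * real (card J) * ln (real k))
                = sqrt (p\<^sup>2) * sqrt (2 * ((1 - p) / p) * real (card J) * ln (real k))"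
              using p by simp
            also have "\<dots> = sqrt (2 * ln (real k) * v * N)"
              unfolding real_sqrt_mult[symmetric] N_def v_def using p
              by (simp add: power2_eq_square mult_ac)
            finally show ?thesis by (simp add: real_sqrt_mult)
          qed
          ultimately show ?thesis
            unfolding ssum_card[OF J(1) T] using p by (simp add: N_def field_simps)
        qed
        then show "of_bool (real (card T) \<ge> (p + u) * N - sqrt N)
          \<le> (of_bool (ssum p J T \<ge> (1 - eps) * sqrt (2 * ((1 - p) / p) * real (card J) * ln (real k))) :: real)"
          by auto
      qed (use p in auto)
      finally show "3 / 4 / real k \<le> bexp p J (\<lambda>T. of_bool
          (ssum p J T \<ge> (1 - eps) * sqrt (2 * ((1 - p) / p) * real (card J) * ln (real k))))" .
    qed
  qed
  then show ?thesis unfolding eventually_sequentially .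
qed

section \<open>Independent blocks and the second Borel-Cantelli lemma\<close>

lemma bexp_prod_disjoint:
  assumes "finite I" "\<And>i. finite (D i)" "disjoint_family D"
  shows "bexp p (\<Union>i\<in>I. D i) (\<lambda>T. \<Prod>i\<in>I. F i (T \<inter> D i)) = (\<Prod>i\<in>I. bexp p (D i) (F i))"
  using assms(1)
proof (induction I rule: finite_induct)
  case (insert j I)
  define K where "K = (\<Union>i\<in>I. D i)"
  have K: "finite K" "D j \<inter> K = {}"
  proof -
    have "D j \<inter> D i = {}" if "i \<in> I" for i
      using assms(3) that insert.hyps(2) unfolding disjoint_family_on_def by (metis UNIV_I)
    then show "finite K" "D j \<inter> K = {}"
      using insert.hyps(1) assms(2) by (auto simp: K_def)
  qed
  have Int: "T \<inter> K \<inter> D i = T \<inter> D i" if "i \<in> I" for T i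
    using that by (auto simp: K_def)
  have "bexp p (\<Union>i\<in>insert j I. D i) (\<lambda>T. \<Prod>i\<in>insert j I. F i (T \<inter> D i))
      = bexp p (D j \<union> K) (\<lambda>T. F j (T \<inter> D j) * (\<Prod>i\<in>I. F i (T \<inter> K \<inter> D i)))"
    using insert by (simp add: K_def Int[unfolded K_def] cong: prod.cong)
  also have "\<dots> = bexp p (D j) (F j) * bexp p K (\<lambda>T. \<Prod>i\<in>I. F i (T \<inter> D i))"
    using bexp_mult_disjoint[OF assms(2) K, of p "F j" "\<lambda>T. \<Prod>i\<in>I. F i (T \<inter> D i)"] .
  finally show ?case using insert by (simp add: K_def)
qed simp

context random_bipartite_graph
begin

text \<open>By disjointness of the \<open>D k\<close>, the probability that no event with index in
  \<open>{m..<n}\<close> occurs is the product of the factors \<open>1 - b k\<close>. It is at most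
  the exponential of minus the sum of the \<open>b k\<close>, which tends to zero as
  \<open>n\<close> grows.\<close>

lemma frequently_AE_cells:
  assumes p: "0 \<le> p" "p \<le> 1" and fin: "\<And>k. finite (D k)" and dis: "disjoint_family D"
    and div: "\<not> summable (\<lambda>k. bexp p (D k) (\<lambda>T. of_bool (P k T)))"
  shows "AE \<omega> in M. \<exists>\<^sub>F k in sequentially. P k (cells (G \<omega>) \<inter> D k)"
proof -
  define b where "b k = bexp p (D k) (\<lambda>T. of_bool (P k T))" for k
  have b0: "b k \<ge> 0" for k
    using p by (auto simp: b_def bexp_def intro!: sum_nonneg)
  have b1: "bexp p (D k) (\<lambda>T. of_bool (\<not> P k T)) = 1 - b k" for k
  proof -
    have "bexp p (D k) (\<lambda>T. of_bool (\<not> P k T) + of_bool (P k T)) = bexp p (D k) (\<lambda>_. 1)"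
      by (rule bexp_cong) auto
    then show ?thesis unfolding bexp_add b_def by (simp add: bexp_const fin)
  qed
  have bound: "prob {\<omega> \<in> space M. \<forall>k\<in>{m..<n}. \<not> P k (cells (G \<omega>) \<inter> D k)} \<le> exp (- (\<Sum>k\<in>{m..<n}. b k))"
    and meas: "{\<omega> \<in> space M. \<forall>k\<in>{m..<n}. \<not> P k (cells (G \<omega>) \<inter> D k)} \<in> events" for m n
  proof -
    define K where "K = (\<Union>k\<in>{m..<n}. D k)"
    have K: "finite K" using fin by (simp add: K_def)
    have Int: "cells (G \<omega>) \<inter> D k = (cells (G \<omega>) \<inter> K) \<inter> D k" if "k \<in> {m..<n}" for k \<omega>
      using that by (auto simp: K_def)
    have eq: "{\<omega> \<in> space M. \<forall>k\<in>{m..<n}. \<not> P k (cells (G \<omega>) \<inter> D k)}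
        = {\<omega> \<in> space M. (\<lambda>T. \<forall>k\<in>{m..<n}. \<not> P k (T \<inter> D k)) (cells (G \<omega>) \<inter> K)}"
      using Int by auto
    show "{\<omega> \<in> space M. \<forall>k\<in>{m..<n}. \<not> P k (cells (G \<omega>) \<inter> D k)} \<in> events"
      unfolding eq by (rule cells_event[OF K])
    have "prob {\<omega> \<in> space M. \<forall>k\<in>{m..<n}. \<not> P k (cells (G \<omega>) \<inter> D k)}
        = bexp p K (\<lambda>T. of_bool (\<forall>k\<in>{m..<n}. \<not> P k (T \<inter> D k)))"
      unfolding eq by (rule prob_cells[OF K])
    also have "\<dots> = bexp p K (\<lambda>T. \<Prod>k\<in>{m..<n}. of_bool (\<not> P k (T \<inter> D k)))"
      by (intro bexp_cong) (auto intro!: prod.neutral[symmetric])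
    also have "\<dots> = (\<Prod>k\<in>{m..<n}. 1 - b k)"
      unfolding K_def by (subst bexp_prod_disjoint[OF _ fin dis, where F = "\<lambda>k T. of_bool (\<not> P k T)"])
        (simp_all add: b1)
    also have "\<dots> \<le> (\<Prod>k\<in>{m..<n}. exp (- b k))"
    proof (rule prod_mono)
      fix k
      have "0 \<le> bexp p (D k) (\<lambda>T. of_bool (\<not> P k T))"
        using p by (auto simp: bexp_def intro!: sum_nonneg)
      then show "0 \<le> 1 - b k \<and> 1 - b k \<le> exp (- b k)"
        using exp_ge_add_one_self[of "- b k"] by (simp add: b1)
    qed
    also have "\<dots> = exp (- (\<Sum>k\<in>{m..<n}. b k))"
      by (simp add: exp_sum sum_negf[symmetric])
    finally show "prob {\<omega> \<in> space M. \<forall>k\<in>{m..<n}. \<not> P k (cells (G \<omega>) \<inter> D k)}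
      \<le> exp (- (\<Sum>k\<in>{m..<n}. b k))" .
  qed
  have "AE \<omega> in M. \<not> (\<forall>k\<ge>m. \<not> P k (cells (G \<omega>) \<inter> D k))" for m
  proof -
    define A where "A = {\<omega> \<in> space M. \<forall>k\<ge>m. \<not> P k (cells (G \<omega>) \<inter> D k)}"
    have A: "A \<in> events"
    proof -
      have "A = (\<Inter>n. {\<omega> \<in> space M. \<forall>k\<in>{m..<n}. \<not> P k (cells (G \<omega>) \<inter> D k)})"
        by (auto simp: A_def) (metis atLeastLessThan_iff lessI)
      also have "\<dots> \<in> events" using meas by (intro sets.countable_INT) auto
      finally show ?thesis .
    qed
    have "prob A \<le> e" if e: "e > 0" for e
    proof -
      have "\<not> bounded (range (\<lambda>n. \<Sum>k<n. b k))"
      proof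
        assume "bounded (range (\<lambda>n. \<Sum>k<n. b k))"
        then obtain C where C: "\<And>n. norm (\<Sum>k<n. b k) \<le> C"
          unfolding bounded_iff by auto
        have "(\<Sum>k\<le>n. b k) \<le> C" for n
          using C[of "Suc n"] unfolding lessThan_Suc_atMost real_norm_def by linarith
        then have "summable b"
          using b0 by (rule bounded_imp_summable[rotated])
        then show False using div by (simp add: b_def[abs_def])
      qed
      then obtain n where n: "norm (\<Sum>k<n. b k) > (\<Sum>k<m. b k) + \<bar>ln e\<bar>"
        unfolding bounded_iff by (auto simp: not_le)
      have "(\<Sum>k<n. b k) \<le> (\<Sum>k<m. b k) + (\<Sum>k\<in>{m..<n}. b k)"
      proof -
        have "(\<Sum>k<n. b k) \<le> (\<Sum>k\<in>{..<m} \<union> {m..<n}. b k)"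
          using b0 by (intro sum_mono2) auto
        also have "\<dots> = (\<Sum>k<m. b k) + (\<Sum>k\<in>{m..<n}. b k)"
          by (rule sum.union_disjoint) auto
        finally show ?thesis .
      qed
      moreover have "norm (\<Sum>k<n. b k) = (\<Sum>k<n. b k)" using b0 by (simp add: sum_nonneg)
      ultimately have s: "- (\<Sum>k\<in>{m..<n}. b k) \<le> ln e" using n by linarith
      have "prob A \<le> prob {\<omega> \<in> space M. \<forall>k\<in>{m..<n}. \<not> P k (cells (G \<omega>) \<inter> D k)}"
        by (intro finite_measure_mono meas) (auto simp: A_def)
      also have "\<dots> \<le> exp (- (\<Sum>k\<in>{m..<n}. b k))" by (rule bound)
      also have "\<dots> \<le> exp (ln e)" using s by simp
      finally show ?thesis using e by simp
    qed
    then have "prob A \<le> 0" by (rule field_le_epsilon[of _ 0, simplified])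
    then have "prob A = 0" using measure_nonneg[of M A] by linarith
    then have "A \<in> null_sets M" using A by (simp add: null_sets_def emeasure_eq_measure)
    then show ?thesis
      by (rule AE_I') (auto simp: A_def)
  qed
  then have "AE \<omega> in M. \<forall>m. \<not> (\<forall>k\<ge>m. \<not> P k (cells (G \<omega>) \<inter> D k))"
    by (simp add: AE_all_countable)
  then show ?thesis
    by eventually_elim (auto simp: frequently_sequentially)
qed

text \<open>The increments over the disjoint sets \<open>D k\<close> between
  \<open>sq (b ^ k)\<close> and \<open>sq (b ^ Suc k)\<close> reach nearly the full level with
  probability at least \<open>3 / (4 * k)\<close>, hence infinitely often. The earlier part
  \<open>S \<omega> (b ^ k)\<close> cannot cancel them: by the upper bound for \<open>- S\<close>
  its negative part is small on the scale of \<open>b ^ Suc k\<close> when \<open>b\<close> is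
  large.\<close>

lemma lil_lower:
  assumes p: "0 < p" "p < 1" and eta: "0 < \<eta>" "\<eta> < 1"
  shows "AE \<omega> in M. \<exists>\<^sub>F n in sequentially.
    S \<omega> n \<ge> (1 - \<eta>) * real n * sqrt (2 * ((1 - p) / p) * ln (ln (real n)))"
proof -
  define q where "q = (1 - p) / p"
  have q: "q > 0" using p by (simp add: q_def)
  define b :: nat where "b = nat \<lceil>16 / \<eta>\<rceil> + 2"
  have b: "real b \<ge> 16 / \<eta>" "b \<ge> 2" unfolding b_def using eta by auto linarith
  define D where "D k = sq (b ^ Suc k) - sq (b ^ k)" for k
  have le: "b ^ k \<le> b ^ Suc k" for k using b by simp
  have fin: "finite (D k)" for k by (simp add: D_def)
  have dis: "disjoint_family D"
  proof -
    have "D i \<inter> D j = {}" if "i < j" for i j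
    proof -
      have "b ^ Suc i \<le> b ^ j" using that b by (intro power_increasing) auto
      then have "sq (b ^ Suc i) \<subseteq> sq (b ^ j)" by (rule sq_mono)
      then show ?thesis by (auto simp: D_def)
    qed
    then show ?thesis unfolding disjoint_family_on_def by (metis Int_commute linorder_neqE_nat)
  qed
  have card_D: "real (card (D k)) = real b ^ (2 * k) * (real b ^ 2 - 1)" for k
  proof -
    have "(b ^ k)\<^sup>2 \<le> (b ^ Suc k)\<^sup>2" using le by (rule power_mono) simp
    moreover have "card (D k) = (b ^ Suc k)\<^sup>2 - (b ^ k)\<^sup>2"
      unfolding D_def by (subst card_Diff_subset) (use sq_mono[OF le] in simp_all)
    ultimately have "real (card (D k)) = (real b ^ Suc k)\<^sup>2 - (real b ^ k)\<^sup>2"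
      by (simp only: of_nat_diff of_nat_power)
    then show ?thesis by (simp add: power_mult power2_eq_square algebra_simps power_mult_distrib)
  qed
  have card_k: "card (D k) \<ge> k" for k
  proof -
    have "real k \<le> 2 ^ k" using of_nat_less_two_power[of k, where 'a = real] by simp
    also have "\<dots> \<le> 2 ^ (2 * k)" by (rule power_increasing) auto
    also have "\<dots> \<le> real b ^ (2 * k)" using b by (intro power_mono) auto
    also have "\<dots> = real b ^ (2 * k) * 1" by simp
    also have "\<dots> \<le> real b ^ (2 * k) * (real b ^ 2 - 1)"
    proof (rule mult_left_mono)
      have "(2 :: real) ^ 2 \<le> real b ^ 2" using b by (intro power_mono) auto
      then show "1 \<le> real b ^ 2 - 1" by simp
    qed simp
    finally show ?thesis unfolding card_D[symmetric] by simp
  qed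
  define P where "P k T \<longleftrightarrow> ssum p (D k) T \<ge> (1 - \<eta> / 4) * sqrt (2 * q * real (card (D k)) * ln (real k))" for k T
  have eta4: "0 < \<eta> / 4" "\<eta> / 4 < 1" using eta by auto
  obtain k0 where k0': "\<And>k J. k \<ge> k0 \<Longrightarrow> finite (J :: (nat \<times> nat) set) \<Longrightarrow> card J \<ge> k \<Longrightarrow>
    3 / 4 / real k \<le> bexp p J (\<lambda>T. of_bool
      (ssum p J T \<ge> (1 - \<eta> / 4) * sqrt (2 * ((1 - p) / p) * real (card J) * ln (real k))))"
    using lil_lower_block[OF p eta4, where 'e = "nat \<times> nat"] by blast
  have k0: "3 / 4 / real k \<le> bexp p (D k) (\<lambda>T. of_bool (P k T))" if "k \<ge> k0" for k
    unfolding P_def q_def using k0'[OF that fin card_k] .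
  have "\<not> summable (\<lambda>k. bexp p (D k) (\<lambda>T. of_bool (P k T)))"
  proof
    assume "summable (\<lambda>k. bexp p (D k) (\<lambda>T. of_bool (P k T)))"
    then have "summable (\<lambda>k. 3 / 4 / real k)"
    proof (rule summable_comparison_test_ev[rotated])
      show "\<forall>\<^sub>F k in sequentially. norm (3 / 4 / real k) \<le> bexp p (D k) (\<lambda>T. of_bool (P k T))"
        using eventually_ge_at_top[of k0] by eventually_elim (use k0 in simp)
    qed
    then have "summable (\<lambda>k. 4 / 3 * (3 / 4 / real k))" by (rule summable_mult)
    also have "(\<lambda>k. 4 / 3 * (3 / 4 / real k)) = (\<lambda>k. inverse (real k))"
      by (rule ext) (simp add: inverse_eq_divide)
    finally show False using not_summable_harmonic[where 'a = real] by blast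
  qed
  then have freq: "AE \<omega> in M. \<exists>\<^sub>F k in sequentially. P k (cells (G \<omega>) \<inter> D k)"
    using p by (intro frequently_AE_cells fin dis) auto
  \<comment> \<open>Slack 1 gives a crude factor 2, which is later divided by
    \<open>b\<close>.\<close>
  have up: "AE \<omega> in M. \<forall>\<^sub>F n in sequentially.
      - 1 * S \<omega> n \<le> (1 + 1) * real n * sqrt (2 * ((1 - p) / p) * ln (ln (real n)))"
    by (rule lil_upper[OF p]) auto
  have pow: "filterlim (\<lambda>k. b ^ k) sequentially sequentially"
    using b by (intro filterlim_subseq strict_monoI power_strict_increasing) auto
  have key: "\<forall>\<^sub>F k in sequentially. (1 - \<eta> / 4) * sqrt (2 * q * real (card (D k)) * ln (real k))
      - 2 * real (b ^ k) * sqrt (2 * q * ln (ln (real (b ^ k))))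
      \<ge> (1 - \<eta>) * real (b ^ Suc k) * sqrt (2 * q * ln (ln (real (b ^ Suc k))))"
  proof -
    have lnb: "ln (real b) > 0" using b by simp
    \<comment> \<open>The blocks provide \<open>ln k\<close>, whereas the normalisation at
      \<open>b ^ Suc k\<close> has \<open>ln ((k + 1) * ln b)\<close>; the two are asymptotically
      equal.\<close>
    have lim: "((\<lambda>k. sqrt (ln (real k) / ln ((real k + 1) * ln (real b)))) \<longlongrightarrow> 1) sequentially"
      using lnb by real_asymp
    \<comment> \<open>With \<open>1 / b \<le> \<eta> / 16\<close> the losses are
      \<open>\<eta> / 2\<close> from the two factors \<open>1 - \<eta> / 4\<close>, at most
      \<open>\<eta> / 16\<close> from the cells of the inner square and at most
      \<open>\<eta> / 8\<close> from \<open>S \<omega> (b ^ k)\<close>.\<close>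
    have c: "(1 - \<eta> / 4) * (1 - 1 / real b ^ 2) * (1 - \<eta> / 4) - 2 / real b \<ge> 1 - \<eta>"
    proof -
      define y where "y = 1 / real b"
      have "y \<le> \<eta> / 16" using b eta by (simp add: y_def field_simps)
      moreover have y: "0 \<le> y" "y \<le> 1" using b by (auto simp: y_def)
      then have "y\<^sup>2 \<le> y" by (simp add: power2_eq_square mult_left_le)
      moreover have "(1 - \<eta> / 4)\<^sup>2 * y\<^sup>2 \<le> 1 * y\<^sup>2"
        using eta by (intro mult_right_mono power_le_one) auto
      moreover have "(1 - \<eta> / 4)\<^sup>2 \<ge> 1 - \<eta> / 2"
        by (simp add: power2_eq_square algebra_simps)
      ultimately have le: "(1 - \<eta> / 4)\<^sup>2 - (1 - \<eta> / 4)\<^sup>2 * y\<^sup>2 - 2 * y \<ge> 1 - \<eta>"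
        using eta by linarith
      have "(1 - \<eta> / 4) * (1 - y\<^sup>2) * (1 - \<eta> / 4) - 2 * y
          = (1 - \<eta> / 4)\<^sup>2 - (1 - \<eta> / 4)\<^sup>2 * y\<^sup>2 - 2 * y"
        by algebra
      moreover have "1 / real b ^ 2 = y\<^sup>2" "2 / real b = 2 * y"
        by (simp_all add: y_def power_divide)
      ultimately show ?thesis
        using le by (simp only:)
    qed
    have ev1: "\<forall>\<^sub>F k in sequentially. 1 - \<eta> / 4 < sqrt (ln (real k) / ln ((real k + 1) * ln (real b)))"
      using eta by (intro order_tendstoD(1)[OF lim]) auto
    have "filterlim (\<lambda>k. real k * ln (real b)) at_top sequentially" using lnb by real_asymp
    then have ev2: "\<forall>\<^sub>F k in sequentially. real k * ln (real b) \<ge> exp 1"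
      by (simp add: filterlim_at_top)
    show ?thesis using ev1 ev2 eventually_gt_at_top[of 0]
    proof eventually_elim
      case (elim k)
      define l where "l = ln ((real k + 1) * ln (real b))"
      define R where "R = real b ^ Suc k * sqrt (2 * q * l)"
      have ln_pow: "ln (real b ^ m) = real m * ln (real b)" for m
        using b by (simp add: ln_realpow)
      have klb: "real k * ln (real b) > 1"
        using elim(2) one_less_exp_iff[of 1] by linarith
      have klb': "real k * ln (real b) \<le> (real k + 1) * ln (real b)"
        using lnb by (intro mult_right_mono) auto
      have l: "ln (real k * ln (real b)) \<le> l" "l > 0"
        using klb klb' by (simp_all add: l_def)
      have R0: "R \<ge> 0" using l q by (simp add: R_def)
      have b2: "1 - 1 / real b ^ 2 \<ge> 0" using b by simp
      \<comment> \<open>The set \<open>D k\<close> has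
        \<open>(1 - 1 / b\<^sup>2) * b ^ (2 * k + 2)\<close> cells. The fraction lies in
        \<open>[0, 1]\<close>, so it is at most its own square root.\<close>
      have "(1 - 1 / real b ^ 2) * (1 - \<eta> / 4) * R \<le> sqrt (1 - 1 / real b ^ 2) * sqrt (ln (real k) / l) * R"
      proof (intro mult_right_mono mult_mono R0)
        have "(1 - 1 / real b ^ 2)\<^sup>2 \<le> 1 - 1 / real b ^ 2"
          using b2 by (simp add: power2_eq_square mult_left_le)
        then show "1 - 1 / real b ^ 2 \<le> sqrt (1 - 1 / real b ^ 2)"
          by (rule real_le_rsqrt)
        show "1 - \<eta> / 4 \<le> sqrt (ln (real k) / l)"
          using elim(1) by (simp add: l_def)
      qed (use eta b2 in auto)
      also have "\<dots> = sqrt (2 * q * real (card (D k)) * ln (real k))"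
      proof -
        have "R = sqrt ((real b ^ Suc k)\<^sup>2 * (2 * q * l))"
          by (simp add: R_def real_sqrt_mult)
        then have "sqrt (1 - 1 / real b ^ 2) * sqrt (ln (real k) / l) * R
            = sqrt ((1 - 1 / real b ^ 2) * (ln (real k) / l) * ((real b ^ Suc k)\<^sup>2 * (2 * q * l)))"
          by (simp only: real_sqrt_mult)
        also have "(1 - 1 / real b ^ 2) * (ln (real k) / l) * ((real b ^ Suc k)\<^sup>2 * (2 * q * l))
            = 2 * q * real (card (D k)) * ln (real k)"
          using l b by (simp add: card_D field_simps power_mult power2_eq_square power_mult_distrib)
        finally show ?thesis .
      qed
      finally have 1: "(1 - \<eta> / 4) * ((1 - 1 / real b ^ 2) * (1 - \<eta> / 4) * R)
          \<le> (1 - \<eta> / 4) * sqrt (2 * q * real (card (D k)) * ln (real k))"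
        using eta by (intro mult_left_mono) auto
      have "2 * real (b ^ k) * sqrt (2 * q * ln (ln (real (b ^ k)))) \<le> 2 * real (b ^ k) * sqrt (2 * q * l)"
        using l q by (intro mult_left_mono real_sqrt_le_mono) (auto simp: ln_pow)
      also have "\<dots> = 2 / real b * R" using b by (simp add: R_def)
      finally have 2: "2 * real (b ^ k) * sqrt (2 * q * ln (ln (real (b ^ k)))) \<le> 2 / real b * R" .
      have "(1 - \<eta>) * R \<le> ((1 - \<eta> / 4) * (1 - 1 / real b ^ 2) * (1 - \<eta> / 4) - 2 / real b) * R"
        using c R0 by (rule mult_right_mono)
      also have "\<dots> = (1 - \<eta> / 4) * ((1 - 1 / real b ^ 2) * (1 - \<eta> / 4) * R) - 2 / real b * R"
        by (simp only: left_diff_distrib[of _ "2 / real b" R] mult.assoc)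
      also have "\<dots> \<le> (1 - \<eta> / 4) * sqrt (2 * q * real (card (D k)) * ln (real k))
          - 2 * real (b ^ k) * sqrt (2 * q * ln (ln (real (b ^ k))))"
        using 1 2 by linarith
      also have "(1 - \<eta>) * R = (1 - \<eta>) * real (b ^ Suc k) * sqrt (2 * q * ln (ln (real (b ^ Suc k))))"
        unfolding R_def l_def of_nat_power ln_pow by (simp add: add.commute)
      finally show ?case .
    qed
  qed
  show ?thesis using freq up
  proof eventually_elim
    case (elim \<omega>)
    have ev: "\<forall>\<^sub>F k in sequentially. - 1 * S \<omega> (b ^ k)
        \<le> (1 + 1) * real (b ^ k) * sqrt (2 * ((1 - p) / p) * ln (ln (real (b ^ k))))"
      using elim(2) pow by (rule eventually_compose_filterlim)
    have "\<forall>\<^sub>F k in sequentially. P k (cells (G \<omega>) \<inter> D k) \<longrightarrow>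
        S \<omega> (b ^ Suc k) \<ge> (1 - \<eta>) * real (b ^ Suc k) * sqrt (2 * q * ln (ln (real (b ^ Suc k))))"
      using ev key
    proof eventually_elim
      case (elim k)
      have "S \<omega> (b ^ Suc k) = S \<omega> (b ^ k) + ssum p (D k) (cells (G \<omega>))"
        unfolding S_def D_def by (rule ssum_Diff) (use sq_mono[OF le] in simp_all)
      then show ?case using elim by (auto simp: P_def q_def)
    qed
    then have "\<exists>\<^sub>F k in sequentially.
        S \<omega> (b ^ Suc k) \<ge> (1 - \<eta>) * real (b ^ Suc k) * sqrt (2 * q * ln (ln (real (b ^ Suc k))))"
      using elim(1) by (rule frequently_rev_mp[rotated])
    moreover have "filterlim (\<lambda>k. b ^ Suc k) sequentially sequentially"
      using b by (intro filterlim_subseq strict_monoI power_strict_increasing) auto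
    ultimately show ?case
      unfolding q_def frequently_def
      using eventually_compose_filterlim[of _ sequentially "\<lambda>k. b ^ Suc k" sequentially] by blast
  qed
qed

end

subsection \<open>The limit superior\<close>

lemma eta_bound:
  assumes "0 < p" "p < 1"
  shows "\<bar>eta p e T\<bar> \<le> 1 / p"
  using assms by (auto simp: eta_def field_simps)

text \<open>The condition on \<open>n\<close> gives \<open>\<bar>y\<bar> \<le> 1/2\<close> for each
  term \<open>y = eta p e T / n\<close>, so \<open>ln (1 + y)\<close> differs from \<open>y\<close>
  by at most \<open>2 * y\<^sup>2 \<le> 2 / (p * n)\<^sup>2\<close>. Summed over
  \<open>n\<^sup>2\<close> cells this no longer depends on \<open>n\<close>.\<close>

lemma ln_cell_prod_bound:
  assumes p: "0 < p" "p < 1" and n: "real n \<ge> 2 / p"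
  shows "cell_prod p n T > 0" "\<bar>ln (cell_prod p n T) - ssum p (sq n) T / real n\<bar> \<le> 2 / p\<^sup>2"
proof -
  have n0: "real n > 0" using n p by (meson divide_pos_pos less_le_trans zero_less_numeral)
  define y where "y e = eta p e T / real n" for e
  have y: "\<bar>y e\<bar> \<le> 1 / (p * real n)" for e
    using divide_right_mono[OF eta_bound[OF p, of e T], of "real n"] n0 by (simp add: y_def)
  have "1 / (p * real n) \<le> 1 / 2" using n n0 p by (simp add: field_simps)
  then have y2: "\<bar>y e\<bar> \<le> 1 / 2" for e using y[of e] by linarith
  then have pos: "1 + y e > 0" for e using y2[of e] by linarith
  show "cell_prod p n T > 0"
    unfolding cell_prod_def y_def[symmetric] using pos by (intro prod_pos) auto
  have ne: "1 + y e \<noteq> 0" for e using pos[of e] by linarith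
  have "ln (cell_prod p n T) = (\<Sum>e\<in>sq n. ln (1 + y e))"
    unfolding cell_prod_def y_def[symmetric] by (intro ln_prod) (simp_all add: pos ne)
  moreover have "ssum p (sq n) T / real n = (\<Sum>e\<in>sq n. y e)"
    by (simp add: ssum_def y_def sum_divide_distrib)
  ultimately have "\<bar>ln (cell_prod p n T) - ssum p (sq n) T / real n\<bar> = \<bar>\<Sum>e\<in>sq n. ln (1 + y e) - y e\<bar>"
    by (simp add: sum_subtractf)
  also have "\<dots> \<le> (\<Sum>e\<in>sq n. 2 * (1 / (p * real n))\<^sup>2)"
  proof (rule order_trans[OF sum_abs sum_mono])
    fix e
    have "\<bar>ln (1 + y e) - y e\<bar> \<le> 2 * \<bar>y e\<bar>\<^sup>2"
      using abs_ln_one_plus_x_minus_x_bound[OF y2[of e]] by simp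
    also have "\<dots> \<le> 2 * (1 / (p * real n))\<^sup>2"
      using y[of e] by (intro mult_left_mono power_mono) auto
    finally show "\<bar>ln (1 + y e) - y e\<bar> \<le> 2 * (1 / (p * real n))\<^sup>2" .
  qed
  also have "\<dots> = 2 / p\<^sup>2" using n0 p by (simp add: power_divide power_mult_distrib)
  finally show "\<bar>ln (cell_prod p n T) - ssum p (sq n) T / real n\<bar> \<le> 2 / p\<^sup>2" .
qed

lemma ln_close:
  fixes y z :: real
  assumes "y > 0" "\<bar>z - y\<bar> \<le> y / 2"
  shows "z > 0" "\<bar>ln z - ln y\<bar> \<le> 1"
proof -
  have z: "y / 2 \<le> z" "z \<le> 2 * y" using assms by linarith+
  then show z0: "z > 0" using assms by linarith
  have "ln (y / 2) \<le> ln z" using z z0 assms by (subst ln_le_cancel_iff) auto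
  moreover have "ln z \<le> ln (2 * y)" using z z0 assms by (subst ln_le_cancel_iff) auto
  moreover have "ln (2 :: real) \<le> 1" using ln_2_less_1 by linarith
  ultimately show "\<bar>ln z - ln y\<bar> \<le> 1"
    using assms by (simp add: ln_div ln_mult abs_le_iff)
qed

lemma limsup_ereal_eq_1:
  fixes f :: "nat \<Rightarrow> real"
  assumes up: "\<And>e. e > 0 \<Longrightarrow> \<forall>\<^sub>F n in sequentially. f n \<le> 1 + e"
    and low: "\<And>e. e > 0 \<Longrightarrow> \<exists>\<^sub>F n in sequentially. f n \<ge> 1 - e"
  shows "limsup (\<lambda>n. ereal (f n)) = 1"
proof (rule antisym)
  show "limsup (\<lambda>n. ereal (f n)) \<le> 1"
  proof (rule ereal_le_epsilon2)
    fix e :: real assume "e > 0"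
    from up[OF this] have "\<forall>\<^sub>F n in sequentially. ereal (f n) \<le> 1 + ereal e"
      by eventually_elim (simp add: one_ereal_def)
    then show "limsup (\<lambda>n. ereal (f n)) \<le> 1 + ereal e"
      by (rule Limsup_bounded)
  qed
  show "1 \<le> limsup (\<lambda>n. ereal (f n))"
  proof (rule ccontr)
    assume "\<not> 1 \<le> limsup (\<lambda>n. ereal (f n))"
    then obtain r :: real where r: "limsup (\<lambda>n. ereal (f n)) < ereal r" "ereal r < 1"
      using ereal_dense2[of "limsup (\<lambda>n. ereal (f n))" 1] by (auto simp: not_le)
    then have "r < 1" by (simp add: one_ereal_def)
    then have "\<exists>\<^sub>F n in sequentially. f n \<ge> r" using low[of "1 - r"] by simp
    moreover have "\<forall>\<^sub>F n in sequentially. ereal (f n) < ereal r"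
      using r(1) by (rule Limsup_lessD)
    then have "\<forall>\<^sub>F n in sequentially. \<not> f n \<ge> r" by eventually_elim simp
    ultimately show False by (simp add: frequently_def)
  qed
qed

text \<open>Almost sure statements can be combined over countably many \<open>e\<close>. The values
  \<open>1 / (m + 2)\<close> are enough for monotone \<open>Q\<close> and stay below 1, as
  \<open>lil_lower\<close> requires.\<close>

lemma all_pos_of_harmonic:
  fixes Q :: "real \<Rightarrow> bool"
  assumes "\<And>m :: nat. Q (1 / (real m + 2))" "\<And>e e'. Q e \<Longrightarrow> e \<le> e' \<Longrightarrow> Q e'" "e > 0"
  shows "Q e"
proof -
  obtain m :: nat where m: "real m > 1 / e" using reals_Archimedean2 by blast
  then have "1 / (real m + 2) \<le> e"
    using assms(3) by (simp add: field_simps add_increasing2)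
  then show ?thesis using assms(1,2) by blast
qed

section \<open>From the sum over the cells to the matching count\<close>

context random_bipartite_graph
begin

lemma matching_count_eq:
  assumes "\<omega> \<in> space M"
  shows "matching_count G n \<omega>
    = card {\<sigma>. \<sigma> permutes {..<n} \<and> graph_on n \<sigma> \<subseteq> cells (G \<omega>) \<inter> sq n}"
proof -
  have "matching_count G n \<omega> = card {\<sigma>. \<sigma> permutes {..<n} \<and> graph_on n \<sigma> \<subseteq> cells (G \<omega>)}"
    unfolding matching_count_def by (rule num_perfect_matchings_eq_permutations[OF bipartite[OF assms]])
  also have "{\<sigma>. \<sigma> permutes {..<n} \<and> graph_on n \<sigma> \<subseteq> cells (G \<omega>)}
      = {\<sigma>. \<sigma> permutes {..<n} \<and> graph_on n \<sigma> \<subseteq> cells (G \<omega>) \<inter> sq n}"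
    using graph_on_permutes(1) by blast
  finally show ?thesis .
qed

lemma log_matching_count_measurable [measurable]:
  "(\<lambda>\<omega>. log_matching_count G n \<omega>) \<in> borel_measurable M"
proof -
  define h where "h T = log_ext (card {\<sigma>. \<sigma> permutes {..<n} \<and> graph_on n \<sigma> \<subseteq> T})" for T
  have "(\<lambda>\<omega>. h (cells (G \<omega>) \<inter> sq n)) \<in> borel_measurable M"
    by (rule measurable_compose[OF measurable_cells[OF finite_sq]]) simp
  also have "?this \<longleftrightarrow> ?thesis"
    by (rule measurable_cong) (simp add: h_def log_matching_count_def matching_count_eq)
  finally show ?thesis .
qed

text \<open>Once \<open>perm_ratio\<close> and \<open>cell_prod\<close> differ by at most half of
  the latter, their logarithms differ by at most 1, and \<open>ln_cell_prod_bound\<close> replaces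
  \<open>ln (cell_prod p n T)\<close> by \<open>S \<omega> n / n\<close>.\<close>

lemma log_matching_count_asymptotics:
  assumes p: "0 < p" "p < 1" and \<omega>: "\<omega> \<in> space M"
    and near: "\<forall>\<^sub>F n in sequentially.
      \<bar>perm_ratio p n (cells (G \<omega>) \<inter> sq n) - cell_prod p n (cells (G \<omega>) \<inter> sq n)\<bar> < real n powr (- 1/8)"
    and low: "\<forall>\<^sub>F n in sequentially.
      - 1 * S \<omega> n \<le> (1 + 1) * real n * sqrt (2 * ((1 - p) / p) * ln (ln (real n)))"
  shows "\<forall>\<^sub>F n in sequentially. \<exists>z. log_matching_count G n \<omega> = ereal (ln (fact n * p ^ n) + z)
    \<and> \<bar>z - S \<omega> n / real n\<bar> \<le> 2 / p\<^sup>2 + 1"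
proof -
  define q where "q = (1 - p) / p"
  have q: "q > 0" using p by (simp add: q_def)
  define c where "c = 2 / p\<^sup>2"
  have c: "c > 0" using p by (simp add: c_def)
  \<comment> \<open>by the lower bound on \<open>S\<close>, \<open>cell_prod\<close> is eventually much larger than the error \<open>n powr (- 1/8)\<close>\<close>
  have ev1: "\<forall>\<^sub>F n in sequentially. real n powr (- 1/8) \<le> exp (- c - 2 * sqrt (2 * q * ln (ln (real n)))) / 2"
    using q c by real_asymp
  have "filterlim real at_top sequentially" by (rule filterlim_real_sequentially)
  then have ev2: "\<forall>\<^sub>F n in sequentially. real n \<ge> 2 / p" by (simp add: filterlim_at_top)
  show ?thesis
    using near low ev1 ev2 eventually_gt_at_top[of 0]
  proof eventually_elim
    case (elim n)
    define T where "T = cells (G \<omega>) \<inter> sq n"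
    have S: "ssum p (sq n) T = S \<omega> n" by (simp add: T_def S_def)
    note E = ln_cell_prod_bound[OF p elim(4), of T, unfolded S, folded c_def]
    have "- (2 * sqrt (2 * q * ln (ln (real n)))) \<le> S \<omega> n / real n"
      using elim(2,5) by (simp add: q_def field_simps)
    then have "- c - 2 * sqrt (2 * q * ln (ln (real n))) \<le> ln (cell_prod p n T)"
      using E(2) by linarith
    then have "exp (- c - 2 * sqrt (2 * q * ln (ln (real n)))) \<le> cell_prod p n T"
      using E(1) by (subst ln_ge_iff[symmetric])
    then have close: "\<bar>perm_ratio p n T - cell_prod p n T\<bar> \<le> cell_prod p n T / 2"
      using elim(1,3) unfolding T_def[symmetric] by linarith
    note Z = ln_close[OF E(1) close]
    have cnt: "perm_ratio p n T = real (matching_count G n \<omega>) / (fact n * p ^ n)"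
      unfolding perm_ratio_def T_def matching_count_eq[OF \<omega>] ..
    have f: "(fact n :: real) * p ^ n > 0" using p by simp
    have mc: "real (matching_count G n \<omega>) = fact n * p ^ n * perm_ratio p n T"
      using p by (simp add: cnt)
    \<comment> \<open>A perfect matching therefore exists, and \<open>log_ext\<close> is
      finite.\<close>
    have "real (matching_count G n \<omega>) > 0"
      unfolding mc using f Z(1) by (rule mult_pos_pos)
    then have m0: "matching_count G n \<omega> \<noteq> 0" by simp
    have "log_matching_count G n \<omega> = ereal (ln (fact n * p ^ n) + ln (perm_ratio p n T))"
      unfolding log_matching_count_def log_ext_def mc using ln_mult_pos[OF f Z(1)] m0 by simp
    moreover have "\<bar>ln (perm_ratio p n T) - S \<omega> n / real n\<bar> \<le> c + 1"
      using Z(2) E(2) by linarith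
    ultimately show ?case unfolding c_def by blast
  qed
qed

text \<open>A deterministic argument for a single \<open>\<omega>\<close>: the quotient differs from
  \<open>S \<omega> n / (n * d n)\<close> by at most \<open>C / d n\<close>, where
  \<open>d n\<close> tends to infinity, so the bounds on \<open>S\<close> carry over.\<close>

lemma limsup_log_matching_count:
  assumes p: "0 < p" "p < 1" and \<omega>: "\<omega> \<in> space M"
    and near: "\<forall>\<^sub>F n in sequentially.
      \<bar>perm_ratio p n (cells (G \<omega>) \<inter> sq n) - cell_prod p n (cells (G \<omega>) \<inter> sq n)\<bar> < real n powr (- 1/8)"
    and low: "\<forall>\<^sub>F n in sequentially.
      - 1 * S \<omega> n \<le> (1 + 1) * real n * sqrt (2 * ((1 - p) / p) * ln (ln (real n)))"
    and up: "\<And>m :: nat. \<forall>\<^sub>F n in sequentially.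
      1 * S \<omega> n \<le> (1 + 1 / (real m + 2)) * real n * sqrt (2 * ((1 - p) / p) * ln (ln (real n)))"
    and freq: "\<And>m :: nat. \<exists>\<^sub>F n in sequentially.
      S \<omega> n \<ge> (1 - 1 / (real m + 2)) * real n * sqrt (2 * ((1 - p) / p) * ln (ln (real n)))"
  shows "limsup (\<lambda>n. (log_matching_count G n \<omega> - ereal (ln (fact n * p ^ n)) + ereal ((1 - p) / (2 * p)))
        / ereal (sqrt (2 * ln (ln (real n))) * sqrt ((1 - p) / p))) = 1"
proof -
  define q where "q = (1 - p) / p"
  have q: "q > 0" using p by (simp add: q_def)
  define d where "d n = sqrt (2 * ln (ln (real n))) * sqrt q" for n :: nat
  have d: "sqrt (2 * q * ln (ln (real n))) = d n" for n :: nat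
    by (simp add: d_def real_sqrt_mult)
  have d_lim: "filterlim d at_top sequentially"
    unfolding d_def using q by real_asymp
  define F where "F n = (log_matching_count G n \<omega> - ereal (ln (fact n * p ^ n)) + ereal ((1 - p) / (2 * p)))
        / ereal (sqrt (2 * ln (ln (real n))) * sqrt ((1 - p) / p))" for n
  \<comment> \<open>\<open>F n\<close> may be infinite for small \<open>n\<close>; it equals
    \<open>ereal (f n)\<close> eventually, which determines the limit superior.\<close>
  define f where "f n = real_of_ereal (F n)" for n
  define C where "C = 2 / p\<^sup>2 + 1 + q / 2"
  have C: "C > 0" using p q by (simp add: C_def add_pos_pos)
  have d_pos: "\<forall>\<^sub>F n in sequentially. d n > 0"
    using d_lim by (simp add: filterlim_at_top_dense)
  have main: "\<forall>\<^sub>F n in sequentially. F n = ereal (f n) \<and> \<bar>f n - S \<omega> n / (real n * d n)\<bar> \<le> C / d n"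
    using log_matching_count_asymptotics[OF p \<omega> near low] d_pos
  proof eventually_elim
    case (elim n)
    then obtain z where z: "log_matching_count G n \<omega> = ereal (ln (fact n * p ^ n) + z)"
      "\<bar>z - S \<omega> n / real n\<bar> \<le> 2 / p\<^sup>2 + 1" by blast
    have F: "F n = ereal ((z + q / 2) / d n)"
      using elim(2) unfolding F_def z(1) q_def[symmetric] d_def[symmetric] by (simp add: q_def)
    have "\<bar>f n - S \<omega> n / (real n * d n)\<bar> = \<bar>z + q / 2 - S \<omega> n / real n\<bar> / d n"
      using elim(2) by (simp add: f_def F diff_divide_distrib[symmetric] flip: divide_divide_eq_left)
    also have "\<dots> \<le> C / d n"
    proof (rule divide_right_mono)
      show "\<bar>z + q / 2 - S \<omega> n / real n\<bar> \<le> C" using z(2) q unfolding C_def by linarith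
    qed (use elim(2) in simp)
    finally show ?case by (simp add: f_def F)
  qed
  have small: "\<forall>\<^sub>F n in sequentially. C / d n < e" if "e > 0" for e
  proof -
    have "((\<lambda>n. C / d n) \<longlongrightarrow> 0) sequentially"
      by (rule real_tendsto_divide_at_top[OF tendsto_const d_lim])
    then show ?thesis using that by (rule order_tendstoD(2))
  qed
  have up': "\<forall>\<^sub>F n in sequentially. S \<omega> n / (real n * d n) \<le> 1 + e" if "e > 0" for e
  proof (rule all_pos_of_harmonic[where Q = "\<lambda>e. \<forall>\<^sub>F n in sequentially. S \<omega> n / (real n * d n) \<le> 1 + e", OF _ _ that])
    fix m :: nat
    show "\<forall>\<^sub>F n in sequentially. S \<omega> n / (real n * d n) \<le> 1 + 1 / (real m + 2)"
      using up[of m] d_pos eventually_gt_at_top[of 0]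
      unfolding q_def[symmetric] d by eventually_elim (simp add: divide_le_eq mult.assoc)
  qed (auto elim: eventually_mono)
  have freq': "\<exists>\<^sub>F n in sequentially. S \<omega> n / (real n * d n) \<ge> 1 - e" if "e > 0" for e
  proof (rule all_pos_of_harmonic[where Q = "\<lambda>e. \<exists>\<^sub>F n in sequentially. S \<omega> n / (real n * d n) \<ge> 1 - e", OF _ _ that])
    fix m :: nat
    have "\<forall>\<^sub>F n in sequentially. S \<omega> n \<ge> (1 - 1 / (real m + 2)) * real n * d n
        \<longrightarrow> S \<omega> n / (real n * d n) \<ge> 1 - 1 / (real m + 2)"
      using d_pos eventually_gt_at_top[of 0] by eventually_elim (simp add: le_divide_eq mult.assoc)
    then show "\<exists>\<^sub>F n in sequentially. S \<omega> n / (real n * d n) \<ge> 1 - 1 / (real m + 2)"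
      using freq[of m] unfolding q_def[symmetric] d by (rule frequently_rev_mp[rotated])
  qed (auto elim!: frequently_elim1)
  have "limsup (\<lambda>n. ereal (f n)) = 1"
  proof (rule limsup_ereal_eq_1)
    fix e :: real assume e: "e > 0"
    then have e2: "e / 2 > 0" by simp
    show "\<forall>\<^sub>F n in sequentially. f n \<le> 1 + e"
      using main small[OF e2] up'[OF e2] by eventually_elim linarith
    have "\<forall>\<^sub>F n in sequentially. S \<omega> n / (real n * d n) \<ge> 1 - e / 2 \<longrightarrow> f n \<ge> 1 - e"
      using main small[OF e2] by eventually_elim linarith
    then show "\<exists>\<^sub>F n in sequentially. f n \<ge> 1 - e"
      using freq'[OF e2] by (rule frequently_rev_mp[rotated])
  qed
  also have "limsup (\<lambda>n. ereal (f n)) = limsup F"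
    by (rule Limsup_eq) (use main in \<open>auto elim: eventually_mono\<close>)
  finally show ?thesis unfolding F_def[abs_def] .
qed

lemma limsup_log_matching_count_AE:
  assumes p: "0 < p" "p < 1"
  shows "AE \<omega> in M. limsup (\<lambda>n. (log_matching_count G n \<omega> - ereal (ln (fact n * p ^ n))
      + ereal ((1 - p) / (2 * p))) / ereal (sqrt (2 * ln (ln (real n))) * sqrt ((1 - p) / p))) = 1"
proof -
  have "AE \<omega> in M. \<forall>m :: nat. \<forall>\<^sub>F n in sequentially.
      1 * S \<omega> n \<le> (1 + 1 / (real m + 2)) * real n * sqrt (2 * ((1 - p) / p) * ln (ln (real n)))"
    unfolding AE_all_countable by (intro allI lil_upper[OF p]) auto
  moreover have "AE \<omega> in M. \<forall>m :: nat. \<exists>\<^sub>F n in sequentially.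
      S \<omega> n \<ge> (1 - 1 / (real m + 2)) * real n * sqrt (2 * ((1 - p) / p) * ln (ln (real n)))"
    unfolding AE_all_countable by (intro allI lil_lower[OF p]) auto
  moreover have "AE \<omega> in M. \<forall>\<^sub>F n in sequentially.
      - 1 * S \<omega> n \<le> (1 + 1) * real n * sqrt (2 * ((1 - p) / p) * ln (ln (real n)))"
    by (rule lil_upper[OF p]) auto
  moreover note perm_ratio_cell_prod_AE[OF p]
  moreover have "AE \<omega> in M. \<omega> \<in> space M" by (rule AE_space)
  ultimately show ?thesis
    by eventually_elim (rule limsup_log_matching_count[OF p]; blast)
qed

end

theorem theorem1p4:
  fixes M :: "'a measure" and p :: real and G :: "'a \<Rightarrow> vertex set set"
  assumes "0 < p" and "p < 1"
    and "random_bipartite_graph M p G"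
  shows "measure M {\<omega> \<in> space M.
      limsup (\<lambda>n. (log_matching_count G n \<omega> - ereal (ln (fact n * p ^ n)) + ereal ((1 - p) / (2 * p)))
        / ereal (sqrt (2 * ln (ln (real n))) * sqrt ((1 - p) / p))) = 1} = 1"
proof -
  interpret random_bipartite_graph M p G by (rule assms(3))
  have "{\<omega> \<in> space M.
      limsup (\<lambda>n. (log_matching_count G n \<omega> - ereal (ln (fact n * p ^ n)) + ereal ((1 - p) / (2 * p)))
        / ereal (sqrt (2 * ln (ln (real n))) * sqrt ((1 - p) / p))) = 1} \<in> events"
    by measurable
  then show ?thesis
    using limsup_log_matching_count_AE[OF assms(1,2)] by (subst prob_eq_1) auto
qed

end
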